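(* Let $d,m\in\mathbb{N}$, $T\in(0,\infty)$, let $D\subseteq\mathbb{R}^d$ be a non-empty set, let $\mu\colon\overline{D}\to\mathbb{R}^d$ and $\sigma\colon\overline{D}\to\mathbb{R}^{d\times m}$ be Borel measurable, let $(\Omega,\mathcal{F},\mathbb{P},(\mathcal{F}_t)_{t\in[0,T]})$ be a filtered probability space satisfying the usual conditions, let $W\colon[0,T]\times\Omega\to\mathbb{R}^m$ be a standard $(\mathcal{F}_t)_{t\in[0,T]}$-Brownian motion, for every $x\in D$ let $X^x\colon[0,T]\times\Omega\to\overline{D}$ be an adapted stochastic process with continuous sample paths satisfying for all $t\in[0,T]$ that $\mathbb{P}$-a.s. it holds that $\int_0^T\|\mu(X^x_s)\|+\|\sigma(X^x_s)\|^2\,ds<\infty$ and $$X^x_t=x+\int_0^t\mu(X^x_s)\,ds+\int_0^t\sigma(X^x_s)\,dW_s,$$ and let $p\in(d,\infty)$, $\alpha\in(\frac dp,1]$ satisfy for all $z\in D$, $n\in\mathbb{N}$ that $(X^z_t)_{t\in[0,T]}\in\mathcal{L}^p(\Omega;C([0,T],\mathbb{R}^d))$ and $$\sup_{x,y\in D\cap B_n(0)}\frac{\mathbb{E}\big[\sup_{t\in[0,T]}\|X^x_t-X^y_t\|^p\big]}{\|x-y\|^{\alpha p}}<\infty.$$ Then there exists a measurable function $Y\colon[0,T]\times\overline{D}\times\Omega\to\overline{D}$ such that (i) for all $\omega\in\Omega$ it holds that $Y(\cdot,\cdot,\omega)$ is continuous, (ii) for all $x\in\overline{D}$ it holds that $Y(\cdot,x,\cdot)$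 is $(\mathcal{F}_t)_{t\in[0,T]}$-adapted, and (iii) for all $t\in[0,T]$, $x\in D$ it holds $\mathbb{P}$-a.s. that $\int_0^T\|\mu(Y(s,x))\|+\|\sigma(Y(s,x))\|^2\,ds<\infty$ and $$Y(t,x)=x+\int_0^t\mu(Y(s,x))\,ds+\int_0^t\sigma(Y(s,x))\,dW_s.$$
   Context: $\overline{D}$ is the closure of $D$ in $\mathbb{R}^d$; $B_n(0)=\{y\in\mathbb{R}^d:\|y\|<n\}$; $\|\cdot\|$ is the Euclidean norm of vectors and the Euclidean operator norm of matrices. $\mathcal{L}^p(\Omega;E)$ is the set of measurable functions $f\colon\Omega\to E$ with $\mathbb{E}[\|f\|_E^p]<\infty$, and $C([0,T],\mathbb{R}^d)$ carries the supremum norm. Conventions: $\frac00=0$ and $\sup(\emptyset)=-\infty$. *)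

theory Defs
  imports "HOL-Probability.Probability"
begin

text \<open>
  Time-indexed objects are functions on the whole type \<^typ>\<open>real\<close>, but everything below only
  constrains and only uses their values at times in \<open>{0..T}\<close>.
  The set \<open>\<Omega>\<close> is \<^term>\<open>space M\<close>.
\<close>

section \<open>Filtered probability spaces and Brownian motion\<close>

text \<open>Completeness of the probability space is not part of the usual conditions here; the
  filtration is only required to contain the null events of \<open>M\<close>.\<close>

definition filtered_prob_space_usual ::
  "'w measure \<Rightarrow> real \<Rightarrow> (real \<Rightarrow> 'w measure) \<Rightarrow> bool" where
  "filtered_prob_space_usual M T F \<longleftrightarrow>
     prob_space M \<and>
     (\<forall>t\<in>{0..T}. subalgebra M (F t)) \<and>
     (\<forall>s\<in>{0..T}. \<forall>t\<in>{s..T}. sets (F s) \<subseteq> sets (F t)) \<and>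
     null_sets M \<subseteq> sets (F 0) \<and>
     (\<forall>t\<in>{0..<T}. sets (F t) = (\<Inter>s\<in>{t<..T}. sets (F s)))"

definition adapted_process ::
  "real \<Rightarrow> (real \<Rightarrow> 'w measure) \<Rightarrow> (real \<Rightarrow> 'w \<Rightarrow> 'a::topological_space) \<Rightarrow> bool" where
  "adapted_process T F X \<longleftrightarrow> (\<forall>t\<in>{0..T}. X t \<in> borel_measurable (F t))"

text \<open>The increments over \<open>[s, t]\<close> have distribution \<open>N(0, (t - s) I)\<close>.\<close>

definition standard_brownian_motion ::
  "'w measure \<Rightarrow> real \<Rightarrow> (real \<Rightarrow> 'w measure) \<Rightarrow> (real \<Rightarrow> 'w \<Rightarrow> real ^ 'm) \<Rightarrow> bool" where
  "standard_brownian_motion M T F W \<longleftrightarrow>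
     adapted_process T F W \<and>
     (AE \<omega> in M. W 0 \<omega> = 0) \<and>
     (AE \<omega> in M. continuous_on {0..T} (\<lambda>t. W t \<omega>)) \<and>
     (\<forall>s\<in>{0..T}. \<forall>t\<in>{s<..T}.
        prob_space.indep_set M (sets (F s))
          {(\<lambda>\<omega>. W t \<omega> - W s \<omega>) -` A \<inter> space M | A. A \<in> sets borel} \<and>
        distributed M lborel (\<lambda>\<omega>. W t \<omega> - W s \<omega>)
          (\<lambda>x. ennreal (\<Prod>i\<in>UNIV. normal_density 0 (sqrt (t - s)) (x $ i))))"

section \<open>The Ito integral\<close>

definition progressively_measurable ::
  "real \<Rightarrow> (real \<Rightarrow> 'w measure) \<Rightarrow> (real \<Rightarrow> 'w \<Rightarrow> 'a::topological_space) \<Rightarrow> bool" where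
  "progressively_measurable T F H \<longleftrightarrow>
     (\<forall>t\<in>{0..T}. (\<lambda>(s, \<omega>). H s \<omega>) \<in> borel_measurable (restrict_space borel {0..t} \<Otimes>\<^sub>M F t))"

text \<open>A simple integrand on \<open>[0, t]\<close> is given by a number \<open>k\<close> of intervals, partition points
  \<open>\<tau> 0 \<le> \<dots> \<le> \<tau> k\<close> and bounded \<open>F (\<tau> i)\<close>-measurable matrices \<open>A i\<close>.\<close>

definition simple_integrand ::
  "'w measure \<Rightarrow> (real \<Rightarrow> 'w measure) \<Rightarrow> real \<Rightarrow> nat \<Rightarrow> (nat \<Rightarrow> real) \<Rightarrow>
   (nat \<Rightarrow> 'w \<Rightarrow> real ^ 'm ^ 'd) \<Rightarrow> bool" where
  "simple_integrand M F t k \<tau> A \<longleftrightarrow>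
     \<tau> 0 = 0 \<and> \<tau> k = t \<and> (\<forall>i<k. \<tau> i \<le> \<tau> (Suc i)) \<and>
     (\<forall>i<k. A i \<in> borel_measurable (F (\<tau> i)) \<and> (\<exists>c. \<forall>\<omega>\<in>space M. norm (A i \<omega>) \<le> c))"

definition simple_process ::
  "nat \<Rightarrow> (nat \<Rightarrow> real) \<Rightarrow> (nat \<Rightarrow> 'w \<Rightarrow> real ^ 'm ^ 'd) \<Rightarrow> real \<Rightarrow> 'w \<Rightarrow> real ^ 'm ^ 'd" where
  "simple_process k \<tau> A s \<omega> = (\<Sum>i<k. indicator {\<tau> i<..\<tau> (Suc i)} s *\<^sub>R A i \<omega>)"

definition simple_integral ::
  "(real \<Rightarrow> 'w \<Rightarrow> real ^ 'm) \<Rightarrow> nat \<Rightarrow> (nat \<Rightarrow> real) \<Rightarrow>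
   (nat \<Rightarrow> 'w \<Rightarrow> real ^ 'm ^ 'd) \<Rightarrow> 'w \<Rightarrow> real ^ 'd" where
  "simple_integral W k \<tau> A \<omega> = (\<Sum>i<k. A i \<omega> *v (W (\<tau> (Suc i)) \<omega> - W (\<tau> i) \<omega>))"

definition tendsto_zero_in_prob :: "'w measure \<Rightarrow> (nat \<Rightarrow> 'w \<Rightarrow> ennreal) \<Rightarrow> bool" where
  "tendsto_zero_in_prob M Z \<longleftrightarrow>
     (\<forall>\<epsilon>>0. (\<lambda>n. emeasure M {\<omega> \<in> space M. ennreal \<epsilon> < Z n \<omega>}) \<longlonglongrightarrow> 0)"

text \<open>\<open>has_ito_integral M F W t H I\<close>: the random variable \<open>I\<close> is a version of
  \<open>\<integral>\<^sub>0\<^sup>t H\<^sub>s dW\<^sub>s\<close>. This is the usual extension of the integral from simple integrands to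
  progressively measurable integrands with almost surely square-integrable paths by
  approximation in probability. It determines \<open>I\<close> up to almost sure equality, which is all that
  the Ito integral does. The norm of a matrix is here the library's one, that is, the
  Hilbert-Schmidt norm.\<close>

definition has_ito_integral ::
  "'w measure \<Rightarrow> (real \<Rightarrow> 'w measure) \<Rightarrow> (real \<Rightarrow> 'w \<Rightarrow> real ^ 'm) \<Rightarrow> real \<Rightarrow>
   (real \<Rightarrow> 'w \<Rightarrow> real ^ 'm ^ 'd) \<Rightarrow> ('w \<Rightarrow> real ^ 'd) \<Rightarrow> bool" where
  "has_ito_integral M F W t H I \<longleftrightarrow>
     progressively_measurable t F H \<and>
     (AE \<omega> in M. (\<integral>\<^sup>+s\<in>{0..t}. ennreal ((norm (H s \<omega>))\<^sup>2) \<partial>lborel) < \<infinity>) \<and>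
     I \<in> borel_measurable M \<and>
     (\<exists>k \<tau> A.
        (\<forall>n. simple_integrand M F t (k n) (\<tau> n) (A n)) \<and>
        tendsto_zero_in_prob M (\<lambda>n \<omega>. \<integral>\<^sup>+s\<in>{0..t}.
          ennreal ((norm (simple_process (k n) (\<tau> n) (A n) s \<omega> - H s \<omega>))\<^sup>2) \<partial>lborel) \<and>
        tendsto_zero_in_prob M (\<lambda>n \<omega>.
          ennreal (norm (simple_integral W (k n) (\<tau> n) (A n) \<omega> - I \<omega>))))"

section \<open>Stochastic differential equations\<close>

text \<open>The matrix norm in the integrability condition is the operator norm.\<close>

definition satisfies_SDE ::
  "'w measure \<Rightarrow> real \<Rightarrow> (real \<Rightarrow> 'w measure) \<Rightarrow> (real \<Rightarrow> 'w \<Rightarrow> real ^ 'm) \<Rightarrow>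
   (real ^ 'd \<Rightarrow> real ^ 'd) \<Rightarrow> (real ^ 'd \<Rightarrow> real ^ 'm ^ 'd) \<Rightarrow> real ^ 'd \<Rightarrow>
   (real \<Rightarrow> 'w \<Rightarrow> real ^ 'd) \<Rightarrow> bool" where
  "satisfies_SDE M T F W \<mu> \<sigma> x X \<longleftrightarrow>
     (\<forall>t\<in>{0..T}. \<exists>I. has_ito_integral M F W t (\<lambda>s \<omega>. \<sigma> (X s \<omega>)) I \<and>
        (AE \<omega> in M.
           (\<integral>\<^sup>+s\<in>{0..T}. ennreal (norm (\<mu> (X s \<omega>)) + (onorm ((*v) (\<sigma> (X s \<omega>))))\<^sup>2) \<partial>lborel) < \<infinity> \<and>
           X t \<omega> = x + (LBINT s:{0..t}. \<mu> (X s \<omega>)) + I \<omega>))"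

section \<open>The space \<open>L\<^sup>p(\<Omega>; C([0, T], \<real>\<^sup>d))\<close>\<close>

definition in_Lp :: "'w measure \<Rightarrow> real \<Rightarrow> ('w \<Rightarrow> 'e::real_normed_vector) \<Rightarrow> bool" where
  "in_Lp M p f \<longleftrightarrow>
     f \<in> borel_measurable M \<and> (\<integral>\<^sup>+\<omega>. ennreal (norm (f \<omega>) powr p) \<partial>M) < \<infinity>"

text \<open>The isometric embedding of \<open>C([0, T], \<real>\<^sup>d)\<close> with the supremum norm into the bounded
  continuous functions on \<open>\<real>\<close>, extending a path by its boundary values.\<close>

definition path_bcontfun :: "real \<Rightarrow> (real \<Rightarrow> real ^ 'd) \<Rightarrow> (real, real ^ 'd) bcontfun" where
  "path_bcontfun T f = Bcontfun (ext_cont f 0 T)"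

end

theory Submission
  imports Defs
begin

text \<open>
  This is the Kolmogorov--Chentsov argument for the \<open>C([0, T], \<real>\<^sup>d)\<close>-valued random field
  \<open>x \<mapsto> X\<^sup>x\<close> on an arbitrary index set \<open>D\<close>. On a bounded part of \<open>D\<close>, select one point in each
  dyadic cube of side \<open>2\<^sup>-\<^sup>k\<close> that meets it. There are \<open>O(2\<^sup>k\<^sup>d)\<close> pairs of selected points at distance
  \<open>O(2\<^sup>-\<^sup>k)\<close>, and since \<open>\<alpha> p > d\<close>, the \<open>p\<close>-th powers of the increments over these pairs, summed
  over all levels with suitable geometric weights, have finite expectation. Hence almost surely
  these increments decay geometrically in \<open>k\<close>, and chaining through the levels gives uniform
  continuity on any prescribed countable subset of \<open>D\<close>. A countable dense subset \<open>D'\<close> yields the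
  continuous extension \<open>Y\<close> to the closure; the subset \<open>D' \<union> {x}\<close> shows that \<open>Y(\<cdot>, x)\<close> and \<open>X\<^sup>x\<close> are
  indistinguishable, so \<open>Y(\<cdot>, x)\<close> inherits the equation.
\<close>

section \<open>Chaining\<close>

text \<open>The vector of the floors of \<open>2 ^ k * x $ j\<close> labels the dyadic cube of side
  \<open>1 / 2 ^ k\<close> that contains \<open>x\<close>, and \<open>\<pi> k\<close> depends on
  that label only. The selected points must lie in \<open>A\<close> itself, because the random field
  is available only there. Boundedness leaves O(\<open>2 ^ (k * CARD('d))\<close>) labels. The
  number of close pairs is of the same order, not its square: once the first label is known, the
  second differs from it by an integer vector from a finite set that does not depend on
  \<open>k\<close>.\<close>

lemma dyadic_net:
  fixes A :: "(real ^ 'd) set"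
  assumes "bounded A"
  obtains \<pi> :: "nat \<Rightarrow> real ^ 'd \<Rightarrow> real ^ 'd"
  where "\<And>k x. x \<in> A \<Longrightarrow> \<pi> k x \<in> A"
    and "\<And>k x. x \<in> A \<Longrightarrow> norm (x - \<pi> k x) \<le> real CARD('d) / 2 ^ k"
    and "\<And>k. finite (\<pi> k ` A)"
    and "\<And>L. \<exists>K. \<forall>k. real (card {(u, v). u \<in> \<pi> k ` A \<and> v \<in> \<pi> k ` A \<and> norm (u - v) \<le> L / 2 ^ k})
           \<le> K * (2 ^ CARD('d)) ^ k"
proof -
  obtain N :: nat where N: "\<And>x. x \<in> A \<Longrightarrow> norm x \<le> real N"
    by (meson assms bounded_iff order_trans real_arch_simple)
  define c :: "nat \<Rightarrow> real ^ 'd \<Rightarrow> 'd \<Rightarrow> int" where "c k x = (\<lambda>j. \<lfloor>2 ^ k * x $ j\<rfloor>)" for k x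
  define \<pi> where "\<pi> k x = (SOME y. y \<in> A \<and> c k y = c k x)" for k x
  have \<pi>: "\<pi> k x \<in> A \<and> c k (\<pi> k x) = c k x" if "x \<in> A" for k x
    unfolding \<pi>_def by (rule someI[of _ x]) (use that in simp)
  have \<pi>_cong: "\<pi> k x = \<pi> k y" if "c k x = c k y" for k x y
    using that by (simp add: \<pi>_def)
  \<comment> \<open>A selected point represents its own cube. Hence two selected points with the
    same label coincide, which makes \<open>c k\<close> injective on the net.\<close>
  have fixed: "\<pi> k u = u" if "u \<in> \<pi> k ` A" for k u
    using that \<pi> \<pi>_cong by (metis imageE)
  define I :: "nat \<Rightarrow> ('d \<Rightarrow> int) set" where "I k = (\<Pi>\<^sub>E j\<in>UNIV. {- int N * 2 ^ k .. int N * 2 ^ k})" for k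
  have finI: "finite (I k)" for k
    unfolding I_def by (intro finite_PiE) auto
  have cI: "c k x \<in> I k" if "x \<in> A" for k x
  proof -
    have "\<bar>x $ j\<bar> \<le> real N" for j
      using N[OF that] component_le_norm_cart[of x j] by linarith
    then have "- real N \<le> x $ j" "x $ j \<le> real N" for j
      by (simp_all add: abs_le_iff minus_le_iff)
    then have "2 ^ k * x $ j \<le> 2 ^ k * real N" "2 ^ k * (- real N) \<le> 2 ^ k * x $ j" for j
      by (intro mult_left_mono; simp)+
    then have "2 ^ k * x $ j \<le> real_of_int (int N * 2 ^ k)" "real_of_int (- int N * 2 ^ k) \<le> 2 ^ k * x $ j" for j
      by (simp_all add: mult.commute)
    then show ?thesis
      unfolding I_def c_def by (auto simp: le_floor_iff intro!: floor_le_iff[THEN iffD2] less_add_one[THEN order_le_less_trans[rotated]])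
  qed
  have cardI: "real (card (I k)) \<le> (2 * real N + 1) ^ CARD('d) * (2 ^ CARD('d)) ^ k" for k
  proof -
    have "card {- int N * 2 ^ k .. int N * 2 ^ k} = 2 * N * 2 ^ k + 1"
      by (simp add: nat_add_distrib nat_mult_distrib nat_power_eq algebra_simps flip: of_nat_mult)
    then have "card (I k) = (2 * N * 2 ^ k + 1) ^ CARD('d)"
      unfolding I_def by (subst card_PiE) auto
    then have "real (card (I k)) = (2 * real N * 2 ^ k + 1) ^ CARD('d)"
      by (simp add: add.commute)
    also have "\<dots> \<le> ((2 * real N + 1) * 2 ^ k) ^ CARD('d)"
      by (intro power_mono) (simp_all add: algebra_simps)
    also have "\<dots> = (2 * real N + 1) ^ CARD('d) * (2 ^ CARD('d)) ^ k"
      by (simp add: power_mult_distrib power_mult[symmetric] mult.commute)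
    finally show ?thesis .
  qed
  have inj: "inj_on (c k) (\<pi> k ` A)" for k
    by (intro inj_onI) (metis fixed \<pi>_cong)
  have fin: "finite (\<pi> k ` A)" for k
    using finite_subset[OF _ finI[of k], of "c k ` \<pi> k ` A"] inj[of k] cI \<pi>
    by (metis finite_imageD image_subsetI image_eqI imageE)
  have count: "\<exists>K. \<forall>k. real (card {(u, v). u \<in> \<pi> k ` A \<and> v \<in> \<pi> k ` A \<and> norm (u - v) \<le> L / 2 ^ k})
           \<le> K * (2 ^ CARD('d)) ^ k" for L
  proof -
    \<comment> \<open>After scaling by \<open>2 ^ k\<close> the coordinates of a close pair differ
      by at most \<open>L\<close>; taking floors changes such a difference by less than one.\<close>
    define l where "l = \<lceil>L\<rceil> + 1"
    define J :: "('d \<Rightarrow> int) set" where "J = (\<Pi>\<^sub>E j\<in>UNIV. {-l..l})"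
    have finJ: "finite J"
      unfolding J_def by (intro finite_PiE) auto
    have "real (card {(u, v). u \<in> \<pi> k ` A \<and> v \<in> \<pi> k ` A \<and> norm (u - v) \<le> L / 2 ^ k})
      \<le> real (card J) * (2 * real N + 1) ^ CARD('d) * (2 ^ CARD('d)) ^ k" (is "real (card ?P) \<le> _") for k
    proof -
      \<comment> \<open>A pair is encoded by the label of its first point and the offset between the
        two labels; for close pairs the offset ranges over the fixed box \<open>J\<close>.\<close>
      define h where "h = (\<lambda>(u, v). (c k u, \<lambda>j. c k v j - c k u j))"
      have "inj_on h ?P"
      proof (rule inj_onI)
        fix w w' assume w: "w \<in> ?P" "w' \<in> ?P" "h w = h w'"
        obtain u v u' v' where uv: "w = (u, v)" "w' = (u', v')" by (metis surj_pair)
        have N: "u \<in> \<pi> k ` A" "v \<in> \<pi> k ` A" "u' \<in> \<pi> k ` A" "v' \<in> \<pi> k ` A" and cu: "c k u = c k u'"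
          and "(\<lambda>j. c k v j - c k u j) = (\<lambda>j. c k v' j - c k u' j)"
          using w by (auto simp: uv h_def)
        then have "c k v = c k v'" by (auto simp: fun_eq_iff)
        with N cu show "w = w'"
          using inj[of k] by (auto simp: uv dest: inj_onD)
      qed
      moreover have "h ` ?P \<subseteq> I k \<times> J"
      proof (clarsimp simp: h_def, intro conjI)
        fix a b assume a: "a \<in> A" "b \<in> A" "norm (\<pi> k a - \<pi> k b) \<le> L / 2 ^ k"
        show "c k (\<pi> k a) \<in> I k"
          using a cI \<pi> by auto
        have "c k (\<pi> k b) j - c k (\<pi> k a) j \<in> {-l..l}" for j
        proof -
          have "\<bar>\<pi> k a $ j - \<pi> k b $ j\<bar> \<le> L / 2 ^ k"
            using component_le_norm_cart[of "\<pi> k a - \<pi> k b" j] a by simp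
          then have "2 ^ k * \<bar>\<pi> k a $ j - \<pi> k b $ j\<bar> \<le> L"
            by (simp add: field_simps)
          then have "\<bar>2 ^ k * \<pi> k a $ j - 2 ^ k * \<pi> k b $ j\<bar> \<le> L"
            by (simp add: abs_mult flip: right_diff_distrib)
          moreover have "\<lfloor>b\<rfloor> - \<lfloor>a\<rfloor> \<in> {- l..l}" if "\<bar>a - b\<bar> \<le> L" for a b
            using that unfolding l_def atLeastAtMost_iff by linarith
          ultimately show ?thesis
            unfolding c_def by blast
        qed
        then show "(\<lambda>j. c k (\<pi> k b) j - c k (\<pi> k a) j) \<in> J"
          unfolding J_def by auto
      qed
      ultimately have "card ?P \<le> card (I k \<times> J)"
        by (intro card_inj_on_le[of h]) (auto simp: finI finJ)
      also have "\<dots> = card J * card (I k)" by (simp add: card_cartesian_product)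
      finally have "real (card ?P) \<le> real (card J) * real (card (I k))"
        by (simp flip: of_nat_mult)
      also have "\<dots> \<le> real (card J) * ((2 * real N + 1) ^ CARD('d) * (2 ^ CARD('d)) ^ k)"
        by (intro mult_left_mono cardI) simp
      finally show ?thesis by (simp add: mult.assoc)
    qed
    then show ?thesis by blast
  qed
  have dist: "norm (x - \<pi> k x) \<le> real CARD('d) / 2 ^ k" if "x \<in> A" for k x
  proof -
    have "\<bar>x $ j - \<pi> k x $ j\<bar> \<le> 1 / 2 ^ k" for j
    proof -
      have "\<lfloor>2 ^ k * x $ j\<rfloor> = \<lfloor>2 ^ k * \<pi> k x $ j\<rfloor>"
        using \<pi>[OF that, of k] by (auto simp: c_def fun_eq_iff)
      then have "\<bar>2 ^ k * x $ j - 2 ^ k * \<pi> k x $ j\<bar> \<le> 1" by linarith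
      also have "2 ^ k * x $ j - 2 ^ k * \<pi> k x $ j = 2 ^ k * (x $ j - \<pi> k x $ j)"
        by (rule right_diff_distrib[symmetric])
      finally show ?thesis
        by (simp add: abs_mult le_divide_eq mult.commute)
    qed
    \<comment> \<open>The Euclidean norm is estimated by the sum of the coordinates, whence the
      factor \<open>CARD('d)\<close> in the mesh bound.\<close>
    then have "(\<Sum>j\<in>UNIV. \<bar>(x - \<pi> k x) $ j\<bar>) \<le> (\<Sum>j\<in>(UNIV::'d set). 1 / 2 ^ k)"
      by (intro sum_mono) simp
    then show ?thesis
      using norm_le_l1_cart[of "x - \<pi> k x"] by simp
  qed
  show thesis
  proof (rule that[of \<pi>])
    show "\<pi> k x \<in> A" if "x \<in> A" for k x
      using \<pi>[OF that] by (rule conjunct1)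
  qed (fact dist fin count)+
qed

text \<open>The moments decay like \<open>q ^ (2 * k)\<close>. One factor \<open>q ^ k\<close> is
  spent on the weights \<open>(1 / q) ^ k\<close>, the other keeps the expected weighted total
  summable. The total is therefore almost surely finite, and its value serves as the random constant
  \<open>B\<close>.\<close>

lemma AE_geometric_bound:
  fixes Q :: "'i \<Rightarrow> 'w \<Rightarrow> ennreal" and P :: "nat \<Rightarrow> 'i set"
  assumes q: "0 < q" "q < 1" and K: "0 \<le> K"
    and meas: "\<And>k i. i \<in> P k \<Longrightarrow> Q i \<in> borel_measurable M"
    and moment: "\<And>k. (\<Sum>i\<in>P k. \<integral>\<^sup>+\<omega>. Q i \<omega> \<partial>M) \<le> ennreal (K * (q\<^sup>2) ^ k)"
    and fin: "\<And>k. finite (P k)"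
  shows "AE \<omega> in M. \<exists>B\<ge>0. \<forall>k. \<forall>i\<in>P k. Q i \<omega> \<le> ennreal (B * q ^ k)"
proof -
  define g where "g k \<omega> = ennreal ((1 / q) ^ k) * (\<Sum>i\<in>P k. Q i \<omega>)" for k \<omega>
  have g_meas [measurable]: "g k \<in> borel_measurable M" for k
    unfolding g_def using meas by (auto intro!: borel_measurable_times borel_measurable_sum)
  have "(\<integral>\<^sup>+\<omega>. (\<Sum>k. g k \<omega>) \<partial>M) = (\<Sum>k. \<integral>\<^sup>+\<omega>. g k \<omega> \<partial>M)"
    by (rule nn_integral_suminf) simp
  also have "\<dots> \<le> (\<Sum>k. ennreal (K * q ^ k))"
  proof (rule suminf_le)
    fix k
    have "(\<integral>\<^sup>+\<omega>. g k \<omega> \<partial>M) = ennreal ((1 / q) ^ k) * (\<Sum>i\<in>P k. \<integral>\<^sup>+\<omega>. Q i \<omega> \<partial>M)"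
      unfolding g_def using meas by (subst nn_integral_cmult) (auto simp: nn_integral_sum)
    also have "\<dots> \<le> ennreal ((1 / q) ^ k) * ennreal (K * (q\<^sup>2) ^ k)"
      by (intro mult_left_mono moment) simp
    also have "\<dots> = ennreal (K * q ^ k)"
      using q K by (simp add: field_simps power2_eq_square power_mult_distrib flip: ennreal_mult)
    finally show "(\<integral>\<^sup>+\<omega>. g k \<omega> \<partial>M) \<le> ennreal (K * q ^ k)" .
  qed auto
  also have "\<dots> = ennreal (\<Sum>k. K * q ^ k)"
    using q K by (intro suminf_ennreal2) (auto intro!: summable_mult summable_geometric)
  finally have "(\<integral>\<^sup>+\<omega>. (\<Sum>k. g k \<omega>) \<partial>M) \<noteq> \<infinity>"
    by (metis ennreal_neq_top infinity_ennreal_def top.extremum_uniqueI)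
  then have "AE \<omega> in M. (\<Sum>k. g k \<omega>) \<noteq> \<infinity>"
    by (intro nn_integral_PInf_AE) auto
  then show ?thesis
  proof (rule AE_mp, intro AE_I2 impI)
    fix \<omega> assume fin_sum: "(\<Sum>k. g k \<omega>) \<noteq> \<infinity>"
    define B where "B = enn2real (\<Sum>k. g k \<omega>)"
    have B: "(\<Sum>k. g k \<omega>) = ennreal B"
      using fin_sum by (simp add: B_def top.not_eq_extremum)
    have "Q i \<omega> \<le> ennreal (B * q ^ k)" if i: "i \<in> P k" for i k
    proof -
      have "Q i \<omega> \<le> (\<Sum>i\<in>P k. Q i \<omega>)"
        using i fin by (intro member_le_sum) auto
      also have "\<dots> = ennreal (q ^ k) * g k \<omega>"
        unfolding g_def using q by (simp add: mult.assoc[symmetric] field_simps flip: ennreal_mult)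
      also have "\<dots> \<le> ennreal (q ^ k) * ennreal B"
        using sum_le_suminf[of "\<lambda>k. g k \<omega>" "{k}"] by (intro mult_left_mono) (auto simp flip: B)
      also have "\<dots> = ennreal (B * q ^ k)"
        using q by (simp add: mult.commute ennreal_mult'')
      finally show ?thesis .
    qed
    then show "\<exists>B\<ge>0. \<forall>k. \<forall>i\<in>P k. Q i \<omega> \<le> ennreal (B * q ^ k)"
      by (intro exI[of _ B]) (auto simp: B_def)
  qed
qed

text \<open>This is the deterministic half of the argument, for one fixed outcome. Each of two close
  points \<open>x\<close>, \<open>y\<close> is tied to a net point of a deep level \<open>m\<close>,
  the net points are carried down to level \<open>k\<close> by successive projections, and there
  they are close enough for \<open>pairs\<close>. All increments on the way form a geometric series,
  so the bound does not depend on \<open>m\<close>. This is why \<open>points\<close> may start at a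
  level that depends on the point while \<delta> stays uniform.\<close>

lemma chaining:
  fixes \<pi> :: "nat \<Rightarrow> 'x::real_normed_vector \<Rightarrow> 'x" and f :: "'x \<Rightarrow> 't \<Rightarrow> 'b::real_normed_vector"
  assumes r: "0 < r" "r < 1" and b: "0 \<le> b" and d: "0 \<le> d" and EA: "E \<subseteq> A"
    and \<pi>: "\<And>k x. x \<in> A \<Longrightarrow> \<pi> k x \<in> A"
    and \<pi>_near: "\<And>k x. x \<in> A \<Longrightarrow> norm (x - \<pi> k x) \<le> d / 2 ^ k"
    and levels: "\<And>k u t. u \<in> \<pi> (Suc k) ` A \<Longrightarrow> t \<in> S \<Longrightarrow> norm (f u t - f (\<pi> k u) t) \<le> b * r ^ k"
    and pairs: "\<And>k u v t. u \<in> \<pi> k ` A \<Longrightarrow> v \<in> \<pi> k ` A \<Longrightarrow> norm (u - v) \<le> (1 + 6 * d) / 2 ^ k \<Longrightarrow>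
      t \<in> S \<Longrightarrow> norm (f u t - f v t) \<le> b * r ^ k"
    and points: "\<And>x. x \<in> E \<Longrightarrow> \<exists>j. \<forall>m\<ge>j. \<forall>t\<in>S. norm (f x t - f (\<pi> m x) t) \<le> b * r ^ m"
    and \<epsilon>: "0 < \<epsilon>"
  shows "\<exists>\<delta>>0. \<forall>x\<in>E. \<forall>y\<in>E. norm (x - y) < \<delta> \<longrightarrow> (\<forall>t\<in>S. norm (f x t - f y t) \<le> \<epsilon>)"
proof -
  \<comment> \<open>The right-hand sides are the partial geometric sums of \<open>d / 2 ^ i\<close>
    and \<open>b * r ^ i\<close> over \<open>k \<le> i < m\<close>. They are kept in closed form so
    that one more projection, from level \<open>Suc m\<close> to level \<open>m\<close>, adds
    exactly one term.\<close>
  have descend: "\<exists>u\<in>\<pi> k ` A. norm (x - u) \<le> 2 * d / 2 ^ k - 2 * d / 2 ^ m \<and>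
      (\<forall>t\<in>S. norm (f x t - f u t) \<le> b * (r ^ k - r ^ m) / (1 - r))"
    if "k \<le> m" "x \<in> \<pi> m ` A" for k m x
    using that
  proof (induction m arbitrary: x rule: nat_induct_at_least)
    case base
    then show ?case by (intro bexI[of _ x]) auto
  next
    case (Suc m)
    have "x \<in> A" using Suc.prems \<pi> by auto
    then have "\<pi> m x \<in> \<pi> m ` A" by simp
    from Suc.IH[OF this] obtain u where u: "u \<in> \<pi> k ` A"
      "norm (\<pi> m x - u) \<le> 2 * d / 2 ^ k - 2 * d / 2 ^ m"
      "\<And>t. t \<in> S \<Longrightarrow> norm (f (\<pi> m x) t - f u t) \<le> b * (r ^ k - r ^ m) / (1 - r)" by blast
    have "norm (x - u) \<le> norm (x - \<pi> m x) + norm (\<pi> m x - u)"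
      by norm
    also have "\<dots> \<le> d / 2 ^ m + (2 * d / 2 ^ k - 2 * d / 2 ^ m)"
      by (intro add_mono u \<pi>_near \<open>x \<in> A\<close>)
    also have "\<dots> = 2 * d / 2 ^ k - 2 * d / 2 ^ Suc m" by (simp add: field_simps)
    finally have 1: "norm (x - u) \<le> 2 * d / 2 ^ k - 2 * d / 2 ^ Suc m" .
    have 2: "norm (f x t - f u t) \<le> b * (r ^ k - r ^ Suc m) / (1 - r)" if t: "t \<in> S" for t
    proof -
      have "norm (f x t - f u t) \<le> norm (f x t - f (\<pi> m x) t) + norm (f (\<pi> m x) t - f u t)"
        by norm
      also have "\<dots> \<le> b * r ^ m + b * (r ^ k - r ^ m) / (1 - r)"
        by (intro add_mono u levels Suc.prems t)
      also have "\<dots> = b * (r ^ k - r ^ Suc m) / (1 - r)"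
        using r by (simp add: field_simps)
      finally show ?thesis .
    qed
    from 1 2 u(1) show ?case by blast
  qed
  \<comment> \<open>The three unit terms pay for the ties at \<open>x\<close> and \<open>y\<close>
    and for the pair at level \<open>k\<close>; the two terms \<open>1 / (1 - r)\<close> pay for the
    two descents.\<close>
  define C where "C = b * (3 + 2 / (1 - r))"
  have close: "norm (f x t - f y t) \<le> C * r ^ k"
    if x: "x \<in> E" and y: "y \<in> E" and xy: "norm (x - y) \<le> 1 / 2 ^ k" and t: "t \<in> S" for x y k t
  proof -
    obtain j1 where j1: "\<And>m. m \<ge> j1 \<Longrightarrow> norm (f x t - f (\<pi> m x) t) \<le> b * r ^ m"
      using points[OF x] t by blast
    obtain j2 where j2: "\<And>m. m \<ge> j2 \<Longrightarrow> norm (f y t - f (\<pi> m y) t) \<le> b * r ^ m"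
      using points[OF y] t by blast
    define m where "m = max k (max j1 j2)"
    have m: "k \<le> m" "j1 \<le> m" "j2 \<le> m" by (auto simp: m_def)
    have A: "x \<in> A" "y \<in> A" using x y EA by auto
    obtain u where u: "u \<in> \<pi> k ` A" "norm (\<pi> m x - u) \<le> 2 * d / 2 ^ k - 2 * d / 2 ^ m"
      "norm (f (\<pi> m x) t - f u t) \<le> b * (r ^ k - r ^ m) / (1 - r)"
      using descend[OF m(1), of "\<pi> m x"] A t by blast
    obtain v where v: "v \<in> \<pi> k ` A" "norm (\<pi> m y - v) \<le> 2 * d / 2 ^ k - 2 * d / 2 ^ m"
      "norm (f (\<pi> m y) t - f v t) \<le> b * (r ^ k - r ^ m) / (1 - r)"
      using descend[OF m(1), of "\<pi> m y"] A t by blast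
    have dm: "d / 2 ^ m \<le> d / 2 ^ k"
      using d m(1) by (intro divide_left_mono power_increasing) auto
    have rm: "r ^ m \<le> r ^ k"
      using r m(1) by (intro power_decreasing) auto
    have "norm (u - v) \<le> norm (\<pi> m x - u) + norm (x - \<pi> m x) + norm (x - y) + norm (y - \<pi> m y) + norm (\<pi> m y - v)"
      by norm
    \<comment> \<open>In units of \<open>1 / 2 ^ k\<close>, each descent costs at most
      \<open>2 * d\<close>, each tie at most \<open>d\<close>, and the distance of \<open>x\<close>
      and \<open>y\<close> at most 1.\<close>
    also have "\<dots> \<le> (1 + 6 * d) / 2 ^ k"
    proof -
      have "2 * d / 2 ^ k = 2 * (d / 2 ^ k)" "2 * d / 2 ^ m = 2 * (d / 2 ^ m)"
        "(1 + 6 * d) / 2 ^ k = 1 / 2 ^ k + 6 * (d / 2 ^ k)"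
        by (simp_all add: add_divide_distrib)
      moreover have "0 \<le> d / 2 ^ m" using d by simp
      ultimately show ?thesis
        using \<pi>_near[OF A(1), of m] \<pi>_near[OF A(2), of m] u(2) v(2) xy dm by linarith
    qed
    finally have uv: "norm (f u t - f v t) \<le> b * r ^ k"
      using pairs u v t by blast
    have tail: "b * (r ^ k - r ^ m) / (1 - r) \<le> b * r ^ k / (1 - r)"
      using r b by (intro divide_right_mono mult_left_mono) auto
    have "norm (f x t - f y t) \<le> norm (f x t - f (\<pi> m x) t) + norm (f (\<pi> m x) t - f u t) + norm (f u t - f v t)
        + norm (f (\<pi> m y) t - f v t) + norm (f y t - f (\<pi> m y) t)"
      by norm
    also have "\<dots> \<le> b * r ^ k + b * r ^ k / (1 - r) + b * r ^ k + b * r ^ k / (1 - r) + b * r ^ k"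
      using j1[OF m(2)] j2[OF m(3)] uv u(3) v(3) tail mult_left_mono[OF rm b] by linarith
    also have "\<dots> = C * r ^ k" by (simp add: C_def algebra_simps)
    finally show ?thesis .
  qed
  have "(\<lambda>k. C * r ^ k) \<longlonglongrightarrow> C * 0"
    using r by (intro tendsto_mult_left LIMSEQ_realpow_zero) auto
  then have "eventually (\<lambda>k. C * r ^ k < \<epsilon>) sequentially"
    using \<epsilon> by (intro order_tendstoD(2)[of _ "C * 0"]) auto
  then obtain k where k: "C * r ^ k < \<epsilon>"
    using eventually_happens sequentially_bot by blast
  show ?thesis
  proof (intro exI[of _ "1 / 2 ^ k"] conjI ballI impI)
    fix x y t assume "x \<in> E" "y \<in> E" "norm (x - y) < 1 / 2 ^ k" "t \<in> S"
    then show "norm (f x t - f y t) \<le> \<epsilon>"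
      using close[of x y k t] k by linarith
  qed simp
qed

text \<open>With the supremum over \<open>t\<close> inside the expectation, the field is treated as
  one with values in functions on \<open>S\<close> under the supremum norm. At level
  \<open>k\<close> there are O(\<open>2 ^ (k * CARD('d))\<close>) relevant pairs, each with a moment
  of order \<open>2 powr (- k * \<beta>)\<close>, so the surplus of \<beta> over the dimension is
  what makes the sums decay. Countability of \<open>E\<close> allows its points to be attached to
  the net one after another.\<close>

lemma kolmogorov_chentsov_countable:
  fixes X :: "real ^ 'd \<Rightarrow> 't \<Rightarrow> 'w \<Rightarrow> 'b::real_normed_vector"
  assumes "bounded A" and E: "countable E" "E \<subseteq> A" and p: "0 < p" and \<beta>: "real CARD('d) < \<beta>"
    and C: "0 \<le> C"
    and meas: "\<And>x y. x \<in> A \<Longrightarrow> y \<in> A \<Longrightarrow>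
      (\<lambda>\<omega>. SUP t\<in>S. ennreal (norm (X x t \<omega> - X y t \<omega>) powr p)) \<in> borel_measurable M"
    and moment: "\<And>x y. x \<in> A \<Longrightarrow> y \<in> A \<Longrightarrow>
      (\<integral>\<^sup>+\<omega>. (SUP t\<in>S. ennreal (norm (X x t \<omega> - X y t \<omega>) powr p)) \<partial>M) \<le> ennreal (C * norm (x - y) powr \<beta>)"
  shows "AE \<omega> in M. \<forall>\<epsilon>>0. \<exists>\<delta>>0. \<forall>x\<in>E. \<forall>y\<in>E. norm (x - y) < \<delta> \<longrightarrow>
    (\<forall>t\<in>S. norm (X x t \<omega> - X y t \<omega>) \<le> \<epsilon>)"
proof (cases "E = {}")
  case False
  obtain \<pi> :: "nat \<Rightarrow> real ^ 'd \<Rightarrow> real ^ 'd" where \<pi>: "\<And>k x. x \<in> A \<Longrightarrow> \<pi> k x \<in> A"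
    and \<pi>_near: "\<And>k x. x \<in> A \<Longrightarrow> norm (x - \<pi> k x) \<le> real CARD('d) / 2 ^ k"
    and fin: "\<And>k. finite (\<pi> k ` A)"
    and count: "\<And>L. \<exists>K. \<forall>k. real (card {(u, v). u \<in> \<pi> k ` A \<and> v \<in> \<pi> k ` A \<and> norm (u - v) \<le> L / 2 ^ k})
           \<le> K * (2 ^ CARD('d)) ^ k"
    using dyadic_net[OF \<open>bounded A\<close>] by blast
  define L where "L = 1 + 6 * real CARD('d)"
  have L: "0 < L" "real CARD('d) \<le> L" by (simp_all add: L_def)
  \<comment> \<open>Pairs at one level, pairs joining consecutive levels, and pairs tying the first \<open>k\<close> points
    of \<open>E\<close> to level \<open>k\<close>; the last ones make the chain from each point of \<open>E\<close> converge.\<close>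
  define P1 where "P1 k = {(u, v). u \<in> \<pi> k ` A \<and> v \<in> \<pi> k ` A \<and> norm (u - v) \<le> L / 2 ^ k}" for k
  define P2 where "P2 k = (\<lambda>u. (u, \<pi> k u)) ` \<pi> (Suc k) ` A" for k
  define P3 where "P3 k = (\<lambda>j. (from_nat_into E j, \<pi> k (from_nat_into E j))) ` {..k}" for k
  define P where "P k = P1 k \<union> P2 k \<union> P3 k" for k
  obtain K where K: "\<And>k. real (card (P1 k)) \<le> K * (2 ^ CARD('d)) ^ k"
    using count[of L] unfolding P1_def by blast
  have K0: "0 \<le> K"
    using order_trans[OF of_nat_0_le_iff K[of 0]] by simp
  have finP1: "finite (P1 k)" for k
    by (rule finite_subset[OF _ finite_cartesian_product[OF fin[of k] fin[of k]]]) (auto simp: P1_def)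
  have finP: "finite (P k)" for k
    using finP1 fin by (simp add: P_def P2_def P3_def)
  have cardP: "real (card (P k)) \<le> (K + K * 2 ^ CARD('d) + 1) * (2 ^ CARD('d)) ^ k" for k
  proof -
    have "card (P2 k) \<le> card (\<pi> (Suc k) ` A)"
      unfolding P2_def by (intro card_image_le fin)
    \<comment> \<open>The diagonal pairs have distance zero and belong to \<open>P1 (Suc k)\<close>,
      so the pair count also bounds the number of net points.\<close>
    also have "\<dots> = card ((\<lambda>u. (u, u)) ` \<pi> (Suc k) ` A)"
      by (intro card_image[symmetric]) (auto simp: inj_on_def)
    also have "\<dots> \<le> card (P1 (Suc k))"
      using L by (intro card_mono finP1) (auto simp: P1_def)
    finally have "real (card (P2 k)) \<le> real (card (P1 (Suc k)))" by simp
    also have "\<dots> \<le> K * 2 ^ CARD('d) * (2 ^ CARD('d)) ^ k"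
      using K[of "Suc k"] by (simp add: mult.assoc)
    finally have 2: "real (card (P2 k)) \<le> K * 2 ^ CARD('d) * (2 ^ CARD('d)) ^ k" .
    have "card (P3 k) \<le> card {..k}"
      unfolding P3_def by (intro card_image_le) simp
    also have "\<dots> \<le> 2 ^ k"
      by (simp add: Suc_le_eq)
    finally have "real (card (P3 k)) \<le> 2 ^ k"
      by (metis of_nat_le_iff of_nat_numeral of_nat_power)
    also have "\<dots> \<le> (2 ^ CARD('d)) ^ k"
      using self_le_power[of "2::real" "CARD('d)"] by (intro power_mono) auto
    finally have 3: "real (card (P3 k)) \<le> (2 ^ CARD('d)) ^ k" .
    have "card (P k) \<le> card (P1 k) + card (P2 k) + card (P3 k)"
      unfolding P_def by (meson card_Un_le add_mono order_refl order_trans)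
    then have "real (card (P k)) \<le> real (card (P1 k)) + real (card (P2 k)) + real (card (P3 k))"
      by (metis of_nat_add of_nat_le_iff)
    also have "\<dots> \<le> K * (2 ^ CARD('d)) ^ k + K * 2 ^ CARD('d) * (2 ^ CARD('d)) ^ k + (2 ^ CARD('d)) ^ k"
      by (intro add_mono K 2 3)
    finally show ?thesis by (simp add: algebra_simps)
  qed
  have enumE: "from_nat_into E j \<in> A" for j
    using from_nat_into[OF False] E by blast
  \<comment> \<open>All three kinds of pairs satisfy the same distance bound, so a single moment
    estimate covers them.\<close>
  have P: "u \<in> A \<and> v \<in> A \<and> norm (u - v) \<le> L / 2 ^ k" if "(u, v) \<in> P k" for u v k
  proof -
    have *: "norm (x - \<pi> k x) \<le> L / 2 ^ k" if "x \<in> A" for x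
      using \<pi>_near[OF that, of k] L(2) by (meson divide_right_mono order_trans zero_le_numeral zero_le_power)
    show ?thesis
      using that \<pi> enumE * unfolding P_def P1_def P2_def P3_def by auto
  qed
  \<comment> \<open>The number of pairs times their moments is of order
    \<open>(2 powr (CARD('d) - \<beta>)) ^ k\<close>; \<open>q\<close> is the square root of that
    ratio, the form required by \<open>AE_geometric_bound\<close>.\<close>
  define q where "q = 2 powr (- (\<beta> - real CARD('d)) / 2)"
  have q: "0 < q" "q < 1"
    using \<beta> by (auto simp: q_def powr_less_one)
  have q2: "q\<^sup>2 = 2 ^ CARD('d) / 2 powr \<beta>"
    by (simp add: q_def power2_eq_square powr_diff powr_realpow flip: powr_add)
  define Q where "Q = (\<lambda>(x, y) \<omega>. SUP t\<in>S. ennreal (norm (X x t \<omega> - X y t \<omega>) powr p))"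
  define K' where "K' = (K + K * 2 ^ CARD('d) + 1) * (C * L powr \<beta>)"
  have "AE \<omega> in M. \<exists>B\<ge>0. \<forall>k. \<forall>i\<in>P k. Q i \<omega> \<le> ennreal (B * q ^ k)"
  proof (rule AE_geometric_bound[OF q])
    show "0 \<le> K'" using K0 C by (simp add: K'_def)
    show "Q i \<in> borel_measurable M" if "i \<in> P k" for i k
      using that P meas by (cases i) (auto simp: Q_def)
    show "finite (P k)" for k by (rule finP)
    show "(\<Sum>i\<in>P k. \<integral>\<^sup>+\<omega>. Q i \<omega> \<partial>M) \<le> ennreal (K' * (q\<^sup>2) ^ k)" for k
    proof -
      have "(\<Sum>i\<in>P k. \<integral>\<^sup>+\<omega>. Q i \<omega> \<partial>M) \<le> (\<Sum>i\<in>P k. ennreal (C * (L / 2 ^ k) powr \<beta>))"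
      proof (rule sum_mono)
        fix i assume i: "i \<in> P k"
        obtain u v where uv: "i = (u, v)" by (cases i)
        have "(\<integral>\<^sup>+\<omega>. Q i \<omega> \<partial>M) \<le> ennreal (C * norm (u - v) powr \<beta>)"
          using moment P i by (simp add: Q_def uv)
        also have "\<dots> \<le> ennreal (C * (L / 2 ^ k) powr \<beta>)"
          using P[of u v k] i \<beta> C by (intro ennreal_leI mult_left_mono powr_mono2) (auto simp: uv)
        finally show "(\<integral>\<^sup>+\<omega>. Q i \<omega> \<partial>M) \<le> ennreal (C * (L / 2 ^ k) powr \<beta>)" .
      qed
      also have "\<dots> = ennreal (real (card (P k)) * (C * (L / 2 ^ k) powr \<beta>))"
        by (simp add: ennreal_mult' ennreal_of_nat_eq_real_of_nat)
      also have "\<dots> \<le> ennreal ((K + K * 2 ^ CARD('d) + 1) * (2 ^ CARD('d)) ^ k * (C * (L / 2 ^ k) powr \<beta>))"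
        using C by (intro ennreal_leI mult_right_mono cardP) auto
      also have "(L / 2 ^ k) powr \<beta> = L powr \<beta> / (2 powr \<beta>) ^ k"
      proof -
        have "(2 ^ k) powr \<beta> = (2 powr \<beta>) ^ k"
          by (simp add: powr_powr mult.commute flip: powr_realpow)
        then show ?thesis using L by (simp add: powr_divide)
      qed
      also have "(K + K * 2 ^ CARD('d) + 1) * (2 ^ CARD('d)) ^ k * (C * (L powr \<beta> / (2 powr \<beta>) ^ k))
          = K' * (q\<^sup>2) ^ k"
        by (simp add: K'_def q2 power_divide)
      finally show ?thesis .
    qed
  qed
  then show ?thesis
  proof (rule AE_mp, intro AE_I2 impI allI)
    fix \<omega> \<epsilon> assume "\<exists>B\<ge>0. \<forall>k. \<forall>i\<in>P k. Q i \<omega> \<le> ennreal (B * q ^ k)" and \<epsilon>: "0 < (\<epsilon>::real)"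
    then obtain B where B: "0 \<le> B" "\<And>k i. i \<in> P k \<Longrightarrow> Q i \<omega> \<le> ennreal (B * q ^ k)" by blast
    \<comment> \<open>Taking \<open>p\<close>-th roots turns the bound \<open>B * q ^ k\<close> on
      the powers into a bound \<open>b * r ^ k\<close> on the increments.\<close>
    define r where "r = q powr (1 / p)"
    define b where "b = B powr (1 / p)"
    have bound: "norm (X u t \<omega> - X v t \<omega>) \<le> b * r ^ k" if uv: "(u, v) \<in> P k" and t: "t \<in> S" for u v k t
    proof -
      have "ennreal (norm (X u t \<omega> - X v t \<omega>) powr p) \<le> Q (u, v) \<omega>"
        unfolding Q_def using t by (auto intro: SUP_upper)
      also note B(2)[OF uv]
      finally have "norm (X u t \<omega> - X v t \<omega>) powr p \<le> B * q ^ k"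
        using B q by (subst (asm) ennreal_le_iff) auto
      then have "(norm (X u t \<omega> - X v t \<omega>) powr p) powr (1 / p) \<le> (B * q ^ k) powr (1 / p)"
        using p by (intro powr_mono2) auto
      also have "(norm (X u t \<omega> - X v t \<omega>) powr p) powr (1 / p) = norm (X u t \<omega> - X v t \<omega>)"
        using p by (simp add: powr_powr)
      also have "(B * q ^ k) powr (1 / p) = b * r ^ k"
        using B q by (simp add: powr_mult b_def r_def powr_powr mult.commute flip: powr_realpow)
      finally show ?thesis .
    qed
    show "\<exists>\<delta>>0. \<forall>x\<in>E. \<forall>y\<in>E. norm (x - y) < \<delta> \<longrightarrow> (\<forall>t\<in>S. norm (X x t \<omega> - X y t \<omega>) \<le> \<epsilon>)"
    proof (rule chaining[where \<pi> = \<pi> and A = A and b = b and r = r and d = "real CARD('d)"])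
      show "0 < r" using q by (simp add: r_def)
      show "r < 1" using powr_less_mono2[of "1 / p" q 1] q p by (simp add: r_def)
      show "0 \<le> b" by (simp add: b_def)
      show "norm (X u t \<omega> - X (\<pi> k u) t \<omega>) \<le> b * r ^ k" if "u \<in> \<pi> (Suc k) ` A" "t \<in> S" for k u t
        by (rule bound) (use that in \<open>auto simp: P_def P2_def\<close>)
      show "norm (X u t \<omega> - X v t \<omega>) \<le> b * r ^ k"
        if "u \<in> \<pi> k ` A" "v \<in> \<pi> k ` A" "norm (u - v) \<le> (1 + 6 * real CARD('d)) / 2 ^ k" "t \<in> S" for k u v t
        by (rule bound) (use that in \<open>auto simp: P_def P1_def L_def\<close>)
      show "\<exists>j. \<forall>m\<ge>j. \<forall>t\<in>S. norm (X x t \<omega> - X (\<pi> m x) t \<omega>) \<le> b * r ^ m" if x: "x \<in> E" for x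
      proof -
        obtain j where j: "x = from_nat_into E j"
          using from_nat_into_surj[OF E(1) x] by metis
        then have "(x, \<pi> m x) \<in> P m" if "m \<ge> j" for m
          using that by (auto simp: P_def P3_def)
        then show ?thesis using bound by blast
      qed
      show "0 \<le> real CARD('d)" by simp
    qed (fact E(2) \<pi> \<pi>_near \<epsilon>)+
  qed
qed (auto intro!: AE_I2 exI[of _ 1])

text \<open>The moment constant may grow with the ball, so uniform continuity is obtained on each
  ball of integer radius, and countably many almost sure events are intersected. The conclusion is a
  Cauchy condition at every point \<open>x\<close> of the whole space, in \<open>E\<close> or not;
  this is the form needed to extend the field to a closure.\<close>

lemma kolmogorov_chentsov_locally:
  fixes X :: "real ^ 'd \<Rightarrow> 't \<Rightarrow> 'w \<Rightarrow> 'b::real_normed_vector"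
  assumes E: "countable E" "E \<subseteq> D" and p: "0 < p" and \<beta>: "real CARD('d) < \<beta>"
    and meas: "\<And>x y. x \<in> D \<Longrightarrow> y \<in> D \<Longrightarrow>
      (\<lambda>\<omega>. SUP t\<in>S. ennreal (norm (X x t \<omega> - X y t \<omega>) powr p)) \<in> borel_measurable M"
    and moment: "\<And>n::nat. \<exists>C\<ge>0. \<forall>x\<in>D \<inter> ball 0 (real n). \<forall>y\<in>D \<inter> ball 0 (real n).
      (\<integral>\<^sup>+\<omega>. (SUP t\<in>S. ennreal (norm (X x t \<omega> - X y t \<omega>) powr p)) \<partial>M) \<le> ennreal (C * norm (x - y) powr \<beta>)"
  shows "AE \<omega> in M. \<forall>x \<epsilon>. 0 < \<epsilon> \<longrightarrow> (\<exists>\<delta>>0. \<forall>y\<in>E. \<forall>z\<in>E. dist y x < \<delta> \<longrightarrow> dist z x < \<delta> \<longrightarrow>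
      (\<forall>t\<in>S. dist (X y t \<omega>) (X z t \<omega>) \<le> \<epsilon>))"
proof -
  have "AE \<omega> in M. \<forall>\<epsilon>>0. \<exists>\<delta>>0. \<forall>x\<in>E \<inter> ball 0 (real n). \<forall>y\<in>E \<inter> ball 0 (real n).
      norm (x - y) < \<delta> \<longrightarrow> (\<forall>t\<in>S. norm (X x t \<omega> - X y t \<omega>) \<le> \<epsilon>)" for n :: nat
  proof -
    obtain C where C: "0 \<le> C" "\<And>x y. x \<in> D \<inter> ball 0 (real n) \<Longrightarrow> y \<in> D \<inter> ball 0 (real n) \<Longrightarrow>
      (\<integral>\<^sup>+\<omega>. (SUP t\<in>S. ennreal (norm (X x t \<omega> - X y t \<omega>) powr p)) \<partial>M) \<le> ennreal (C * norm (x - y) powr \<beta>)"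
      using moment[of n] by blast
    show ?thesis
    proof (rule kolmogorov_chentsov_countable[where A = "D \<inter> ball 0 (real n)", OF _ _ _ p \<beta> C(1) _ C(2)])
      show "bounded (D \<inter> ball 0 (real n))"
        by (rule bounded_subset[OF bounded_ball Int_lower2])
    qed (use E meas in auto)
  qed
  then have "AE \<omega> in M. \<forall>n. \<forall>\<epsilon>>0. \<exists>\<delta>>0. \<forall>x\<in>E \<inter> ball 0 (real n). \<forall>y\<in>E \<inter> ball 0 (real n).
      norm (x - y) < \<delta> \<longrightarrow> (\<forall>t\<in>S. norm (X x t \<omega> - X y t \<omega>) \<le> \<epsilon>)"
    by (subst AE_all_countable) blast
  then show ?thesis
  proof eventually_elim
    case (elim \<omega>)
    show ?case
    proof (intro allI impI)
      fix x :: "real ^ 'd" and \<epsilon> :: real assume \<epsilon>: "0 < \<epsilon>"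
      obtain n :: nat where n: "norm x + 1 < real n"
        using reals_Archimedean2 by blast
      obtain \<delta> where \<delta>: "\<delta> > 0" "\<And>y z t. y \<in> E \<inter> ball 0 (real n) \<Longrightarrow> z \<in> E \<inter> ball 0 (real n) \<Longrightarrow>
          norm (y - z) < \<delta> \<Longrightarrow> t \<in> S \<Longrightarrow> norm (X y t \<omega> - X z t \<omega>) \<le> \<epsilon>"
        using elim \<epsilon> by meson
      have ball: "y \<in> ball 0 (real n)" if "dist y x < 1" for y
      proof -
        have "norm y \<le> norm x + dist y x" by norm
        with that n show ?thesis by simp
      qed
      \<comment> \<open>The radius 1 keeps both points inside the ball of radius \<open>n\<close>;
        the radius \<open>\<delta> / 2\<close> bounds their mutual distance by the triangle
        inequality through \<open>x\<close>.\<close>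
      have "dist (X y t \<omega>) (X z t \<omega>) \<le> \<epsilon>"
        if "y \<in> E" "z \<in> E" "dist y x < min 1 (\<delta> / 2)" "dist z x < min 1 (\<delta> / 2)" "t \<in> S" for y z t
      proof -
        have "norm (y - z) \<le> dist y x + dist z x" by norm
        also have "\<dots> < \<delta>" using that by auto
        finally show ?thesis
          using \<delta>(2)[of y z t] ball[of y] ball[of z] that by (simp add: dist_norm)
      qed
      then show "\<exists>\<delta>>0. \<forall>y\<in>E. \<forall>z\<in>E. dist y x < \<delta> \<longrightarrow> dist z x < \<delta> \<longrightarrow>
          (\<forall>t\<in>S. dist (X y t \<omega>) (X z t \<omega>) \<le> \<epsilon>)"
        using \<delta>(1) by (intro exI[of _ "min 1 (\<delta> / 2)"]) auto
    qed
  qed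
qed

section \<open>Continuity and measurability\<close>

text \<open>The Cauchy condition at \<open>x\<close> gives convergence along \<open>s x\<close>. For
  joint continuity at \<open>(t0, x0)\<close>, a single \<open>y\<close> in \<open>D\<close> near
  \<open>x0\<close> suffices: the limit is close to \<open>f y t\<close> uniformly in
  \<open>t\<close> for all nearby \<open>x\<close>, and \<open>f y\<close> is continuous in
  \<open>t\<close>.\<close>

lemma lim_along_dense_sequences:
  fixes f :: "'x::metric_space \<Rightarrow> 't::topological_space \<Rightarrow> 'b::complete_space"
  assumes cont: "\<And>x. x \<in> D \<Longrightarrow> continuous_on S (f x)"
    and s: "\<And>x k. x \<in> Z \<Longrightarrow> s x k \<in> D" "\<And>x. x \<in> Z \<Longrightarrow> s x \<longlonglongrightarrow> x"
    and cauchy: "\<And>x \<epsilon>. x \<in> Z \<Longrightarrow> 0 < \<epsilon> \<Longrightarrow> \<exists>\<delta>>0. \<forall>y\<in>D. \<forall>z\<in>D. dist y x < \<delta> \<longrightarrow> dist z x < \<delta> \<longrightarrow>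
      (\<forall>t\<in>S. dist (f y t) (f z t) \<le> \<epsilon>)"
  shows tendsto_lim_along: "x \<in> Z \<Longrightarrow> t \<in> S \<Longrightarrow> (\<lambda>k. f (s x k) t) \<longlonglongrightarrow> lim (\<lambda>k. f (s x k) t)"
    and continuous_on_lim_along: "continuous_on (S \<times> Z) (\<lambda>(t, x). lim (\<lambda>k. f (s x k) t))"
proof -
  define g where "g t x = lim (\<lambda>k. f (s x k) t)" for t x
  have near: "eventually (\<lambda>k. dist (s x k) x0 < \<delta>) sequentially" if "x \<in> Z" "dist x x0 < \<delta>" for x x0 \<delta>
    using tendsto_dist[OF s(2)[OF that(1)] tendsto_const[of x0]] that(2) by (rule order_tendstoD)
  have lim: "(\<lambda>k. f (s x k) t) \<longlonglongrightarrow> g t x" if x: "x \<in> Z" and t: "t \<in> S" for x t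
  proof -
    have "Cauchy (\<lambda>k. f (s x k) t)"
    proof (rule metric_CauchyI)
      fix e :: real assume e: "0 < e"
      obtain \<delta> where \<delta>: "\<delta> > 0" "\<And>y z. y \<in> D \<Longrightarrow> z \<in> D \<Longrightarrow> dist y x < \<delta> \<Longrightarrow> dist z x < \<delta> \<Longrightarrow>
          dist (f y t) (f z t) \<le> e / 2"
        using cauchy[OF x half_gt_zero[OF e]] t by blast
      obtain n where n: "\<And>k. k \<ge> n \<Longrightarrow> dist (s x k) x < \<delta>"
        using near[OF x, of x \<delta>] \<delta>(1) by (auto simp: eventually_sequentially)
      have "dist (f (s x i) t) (f (s x j) t) < e" if "i \<ge> n" "j \<ge> n" for i j
        using \<delta>(2)[OF s(1)[OF x] s(1)[OF x] n[OF that(1)] n[OF that(2)]] e by linarith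
      then show "\<exists>n. \<forall>i\<ge>n. \<forall>j\<ge>n. dist (f (s x i) t) (f (s x j) t) < e" by blast
    qed
    then show ?thesis
      unfolding g_def using Cauchy_convergent convergent_LIMSEQ_iff by blast
  qed
  then show "x \<in> Z \<Longrightarrow> t \<in> S \<Longrightarrow> (\<lambda>k. f (s x k) t) \<longlonglongrightarrow> lim (\<lambda>k. f (s x k) t)"
    by (simp add: g_def)
  have "continuous_on (S \<times> Z) (\<lambda>(t, x). g t x)"
  proof (unfold continuous_on_topological, intro ballI allI impI)
    fix w B assume w: "w \<in> S \<times> Z" and B: "open B" "(case w of (t, x) \<Rightarrow> g t x) \<in> B"
    obtain t0 x0 where w_eq: "w = (t0, x0)" by (cases w)
    have t0: "t0 \<in> S" and x0: "x0 \<in> Z" using w w_eq by auto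
    obtain e where e: "e > 0" "ball (g t0 x0) e \<subseteq> B"
      using B w_eq by (auto simp: open_contains_ball)
    have e4: "0 < e / 4" using e(1) by simp
    obtain \<delta> where \<delta>: "\<delta> > 0" "\<And>y z t. y \<in> D \<Longrightarrow> z \<in> D \<Longrightarrow> dist y x0 < \<delta> \<Longrightarrow> dist z x0 < \<delta> \<Longrightarrow> t \<in> S \<Longrightarrow>
        dist (f y t) (f z t) \<le> e / 4"
      using cauchy[OF x0 e4] by blast
    obtain y where y: "y \<in> D" "dist y x0 < \<delta>"
      using eventually_happens[OF near[OF x0, of x0 \<delta>]] \<delta>(1) s(1)[OF x0] by auto
    have close: "dist (g t x) (f y t) \<le> e / 4" if "x \<in> Z" "dist x x0 < \<delta>" "t \<in> S" for x t
    proof (rule tendsto_upperbound[OF tendsto_dist[OF lim tendsto_const]])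
      show "\<forall>\<^sub>F k in sequentially. dist (f (s x k) t) (f y t) \<le> e / 4"
        using near[OF that(1,2)] by eventually_elim (use \<delta>(2) s(1) that y in blast)
    qed (use that in auto)
    obtain U where U: "open U" "t0 \<in> U" "\<And>t. t \<in> S \<Longrightarrow> t \<in> U \<Longrightarrow> f y t \<in> ball (f y t0) (e / 4)"
      using cont[OF y(1), unfolded continuous_on_topological, rule_format, OF t0 open_ball] e4
      by (meson centre_in_ball)
    \<comment> \<open>Three distances of at most \<open>e / 4\<close> are added: from the limit to
      \<open>f y\<close> at \<open>t0\<close>, along \<open>f y\<close> from \<open>t0\<close> to
      \<open>t\<close>, and back to the limit at \<open>t\<close>.\<close>
    have "g t x \<in> B" if "t \<in> S" "x \<in> Z" "t \<in> U" "dist x x0 < \<delta>" for t x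
    proof -
      have "dist (g t0 x0) (g t x) \<le> dist (g t0 x0) (f y t0) + dist (f y t0) (f y t) + dist (g t x) (f y t)"
        using dist_triangle[of "g t0 x0" "g t x" "f y t"] dist_triangle[of "g t0 x0" "f y t" "f y t0"]
        by (simp add: dist_commute)
      also have "\<dots> < e"
        using close[OF x0 _ t0] close[OF that(2,4,1)] U(3)[OF that(1,3)] \<delta>(1) e(1) by auto
      finally show ?thesis using e(2) by auto
    qed
    then show "\<exists>A. open A \<and> w \<in> A \<and> (\<forall>v\<in>S \<times> Z. v \<in> A \<longrightarrow> (case v of (t, x) \<Rightarrow> g t x) \<in> B)"
      using U \<delta>(1) w_eq by (intro exI[of _ "U \<times> ball x0 \<delta>"]) (auto intro!: open_Times simp: dist_commute)
  qed
  then show "continuous_on (S \<times> Z) (\<lambda>(t, x). lim (\<lambda>k. f (s x k) t))"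
    by (simp add: g_def)
qed

text \<open>Replacing \<open>s\<close> by the first member of a dense sequence within
  \<open>1 / Suc n\<close> of it gives functions that involve only countably many sections
  \<open>f (e j)\<close>, hence jointly measurable ones. Continuity in \<open>s\<close> makes them
  converge pointwise to \<open>f\<close>.\<close>

lemma borel_measurable_pair_caratheodory:
  fixes f :: "'s::{metric_space, second_countable_topology} \<Rightarrow> 'w \<Rightarrow> 'b::metric_space"
  assumes cont: "\<And>\<omega>. \<omega> \<in> space M \<Longrightarrow> continuous_on S (\<lambda>s. f s \<omega>)"
    and meas: "\<And>s. s \<in> S \<Longrightarrow> f s \<in> borel_measurable M"
  shows "(\<lambda>(s, \<omega>). f s \<omega>) \<in> borel_measurable (restrict_space borel S \<Otimes>\<^sub>M M)"
proof (cases "S = {}")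
  case True
  then show ?thesis by (auto simp: measurable_def space_pair_measure)
next
  case False
  obtain D where D: "countable D" "D \<subseteq> S" "S \<subseteq> closure D"
    by (rule separable)
  have "D \<noteq> {}" using False D by auto
  define e where "e = from_nat_into D"
  have e: "e j \<in> S" for j
    using from_nat_into[OF \<open>D \<noteq> {}\<close>] D(2) by (auto simp: e_def)
  have dense: "\<exists>j. dist (e j) s < 1 / real (Suc n)" if "s \<in> S" for s n
  proof -
    have "0 < 1 / real (Suc n)" by simp
    moreover have "s \<in> closure D" using that D(3) by blast
    ultimately obtain y where y: "y \<in> D" "dist y s < 1 / real (Suc n)"
      unfolding closure_approachable by blast
    obtain j where "from_nat_into D j = y"
      using from_nat_into_surj[OF D(1) y(1)] by blast
    with y(2) show ?thesis unfolding e_def by blast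
  qed
  \<comment> \<open>Choosing the least admissible index makes the choice measurable in
    \<open>s\<close>.\<close>
  define i where "i n s = (LEAST j. dist (e j) s < 1 / real (Suc n))" for n s
  have i: "dist (e (i n s)) s < 1 / real (Suc n)" if "s \<in> S" for n s
    unfolding i_def using dense[OF that] by (rule LeastI_ex)
  show ?thesis
  proof (rule borel_measurable_LIMSEQ_metric)
    show "(\<lambda>(s, \<omega>). f (e (i n s)) \<omega>) \<in> borel_measurable (restrict_space borel S \<Otimes>\<^sub>M M)" for n
    proof -
      have "(\<lambda>s. LEAST j. dist (e j) s < 1 / real (Suc n)) \<in> borel \<rightarrow>\<^sub>M count_space UNIV"
        by measurable
      then have i_meas: "i n \<in> restrict_space borel S \<rightarrow>\<^sub>M count_space UNIV"
        unfolding i_def by (rule measurable_restrict_space1)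
      have "(\<lambda>z. f (e (i n (fst z))) (snd z)) \<in> borel_measurable (restrict_space borel S \<Otimes>\<^sub>M M)"
      proof (rule measurable_compose_countable[of "\<lambda>j z. f (e j) (snd z)"])
        show "(\<lambda>z. f (e j) (snd z)) \<in> borel_measurable (restrict_space borel S \<Otimes>\<^sub>M M)" for j
          by (rule measurable_compose[OF measurable_snd meas[OF e]])
        show "(\<lambda>z. i n (fst z)) \<in> restrict_space borel S \<Otimes>\<^sub>M M \<rightarrow>\<^sub>M count_space UNIV"
          by (rule measurable_compose[OF measurable_fst i_meas])
      qed
      then show ?thesis by (simp add: case_prod_beta')
    qed
    fix z assume z: "z \<in> space (restrict_space borel S \<Otimes>\<^sub>M M)"
    obtain s \<omega> where zeq: "z = (s, \<omega>)" by (cases z)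
    have s: "s \<in> S" "\<omega> \<in> space M" using z zeq by (auto simp: space_pair_measure space_restrict_space)
    have "(\<lambda>n. e (i n s)) \<longlonglongrightarrow> s"
    proof (rule metric_LIMSEQ_I)
      fix r :: real assume "0 < r"
      then obtain n0 where n0: "1 / real (Suc n0) < r" by (rule nat_approx_posE)
      have "dist (e (i n s)) s < r" if "n \<ge> n0" for n
      proof -
        have "1 / real (Suc n) \<le> 1 / real (Suc n0)" using that by (intro divide_left_mono) auto
        then show ?thesis using i[OF s(1), of n] n0 by linarith
      qed
      then show "\<exists>n0. \<forall>n\<ge>n0. dist (e (i n s)) s < r" by blast
    qed
    then have "(\<lambda>n. f (e (i n s)) \<omega>) \<longlonglongrightarrow> f s \<omega>"
      by (rule continuous_on_tendsto_compose[OF cont[OF s(2)] _ s(1)]) (simp add: e)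
    then show "(\<lambda>n. (\<lambda>(s, \<omega>). f (e (i n s)) \<omega>) z) \<longlonglongrightarrow> (\<lambda>(s, \<omega>). f s \<omega>) z"
      by (simp add: zeq)
  qed
qed

text \<open>Continuity reduces the supremum to a countable dense subset of \<open>S\<close>.\<close>

lemma borel_measurable_SUP_continuous:
  fixes h :: "'s::{metric_space, second_countable_topology} \<Rightarrow> 'w \<Rightarrow> real"
  assumes cont: "\<And>\<omega>. \<omega> \<in> space M \<Longrightarrow> continuous_on S (\<lambda>s. h s \<omega>)"
    and meas: "\<And>s. s \<in> S \<Longrightarrow> h s \<in> borel_measurable M"
  shows "(\<lambda>\<omega>. SUP s\<in>S. ennreal (h s \<omega>)) \<in> borel_measurable M"
proof -
  obtain D where D: "countable D" "D \<subseteq> S" "S \<subseteq> closure D"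
    by (rule separable)
  have eq: "(SUP s\<in>S. ennreal (h s \<omega>)) = (SUP s\<in>D. ennreal (h s \<omega>))" if \<omega>: "\<omega> \<in> space M" for \<omega>
  proof (rule antisym)
    show "(SUP s\<in>S. ennreal (h s \<omega>)) \<le> (SUP s\<in>D. ennreal (h s \<omega>))"
    proof (rule SUP_least)
      fix s assume s: "s \<in> S"
      then obtain u where u: "\<And>n. u n \<in> D" "u \<longlonglongrightarrow> s"
        using D(3) closure_sequential[of s D] by blast
      have "(\<lambda>n. h (u n) \<omega>) \<longlonglongrightarrow> h s \<omega>"
        by (rule continuous_on_tendsto_compose[OF cont[OF \<omega>] u(2) s]) (use u(1) D(2) in \<open>auto intro!: always_eventually\<close>)
      then have "(\<lambda>n. ennreal (h (u n) \<omega>)) \<longlonglongrightarrow> ennreal (h s \<omega>)"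
        by (rule tendsto_ennrealI)
      then show "ennreal (h s \<omega>) \<le> (SUP s\<in>D. ennreal (h s \<omega>))"
        by (rule LIMSEQ_le_const2) (use u(1) in \<open>auto intro!: SUP_upper\<close>)
    qed
  qed (intro SUP_subset_mono D order_refl)
  have "(\<lambda>\<omega>. SUP s\<in>D. ennreal (h s \<omega>)) \<in> borel_measurable M"
    using meas D by (intro borel_measurable_SUP measurable_compose[OF _ measurable_ennreal]) auto
  with eq show ?thesis
    by (simp cong: measurable_cong)
qed

section \<open>Processes indistinguishable from a solution\<close>

lemma usual_filtration:
  assumes "filtered_prob_space_usual M T F"
  shows usual_subalgebra: "t \<in> {0..T} \<Longrightarrow> subalgebra M (F t)"
    and usual_mono: "0 \<le> s \<Longrightarrow> s \<le> t \<Longrightarrow> t \<le> T \<Longrightarrow> subalgebra (F t) (F s)"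
    and usual_null_sets: "0 \<le> t \<Longrightarrow> t \<le> T \<Longrightarrow> null_sets M \<subseteq> sets (F t)"
proof -
  show sub: "subalgebra M (F t)" if "t \<in> {0..T}" for t
    using assms that by (simp add: filtered_prob_space_usual_def)
  show mono: "subalgebra (F t) (F s)" if "0 \<le> s" "s \<le> t" "t \<le> T" for s t
    using assms that sub[of s] sub[of t]
    by (auto simp: filtered_prob_space_usual_def subalgebra_def)
  show "null_sets M \<subseteq> sets (F t)" if "0 \<le> t" "t \<le> T" for t
  proof -
    have "null_sets M \<subseteq> sets (F 0)"
      using assms by (simp add: filtered_prob_space_usual_def)
    also have "\<dots> \<subseteq> sets (F t)"
      using mono[OF order_refl that] by (simp add: subalgebra_def)
    finally show ?thesis .
  qed
qed

text \<open>For each time \<open>r\<close>, joint measurability on \<open>{0..r}\<close> with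
  respect to \<open>F r\<close> follows from continuity in time and adaptedness. Since \<sigma> is
  measurable only on \<open>C\<close>, the process is regarded as a map into \<open>C\<close> before
  composing.\<close>

lemma progressively_measurable_continuous_adapted:
  fixes Z :: "real \<Rightarrow> 'w \<Rightarrow> 'a::metric_space"
  assumes usual: "filtered_prob_space_usual M T F" and T: "T' \<le> T"
    and adapted: "adapted_process T F Z"
    and cont: "\<And>\<omega>. \<omega> \<in> space M \<Longrightarrow> continuous_on {0..T} (\<lambda>t. Z t \<omega>)"
    and range: "\<And>t \<omega>. t \<in> {0..T} \<Longrightarrow> \<omega> \<in> space M \<Longrightarrow> Z t \<omega> \<in> C"
    and \<sigma>: "\<sigma> \<in> borel_measurable (restrict_space borel C)"
  shows "progressively_measurable T' F (\<lambda>s \<omega>. \<sigma> (Z s \<omega>))"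
  unfolding progressively_measurable_def
proof (intro ballI)
  fix r assume "r \<in> {0..T'}"
  then have r: "0 \<le> r" "r \<le> T" using T by auto
  have space_F: "space (F r) = space M"
    using usual_subalgebra[OF usual, of r] r by (simp add: subalgebra_def)
  have "(\<lambda>(s, \<omega>). Z s \<omega>) \<in> borel_measurable (restrict_space borel {0..r} \<Otimes>\<^sub>M F r)"
  proof (rule borel_measurable_pair_caratheodory)
    show "continuous_on {0..r} (\<lambda>s. Z s \<omega>)" if "\<omega> \<in> space (F r)" for \<omega>
      using cont[of \<omega>] that r by (auto simp: space_F intro: continuous_on_subset)
    show "Z s \<in> borel_measurable (F r)" if "s \<in> {0..r}" for s
      using adapted that r usual_mono[OF usual, of s r]
      by (intro measurable_from_subalg[of "F r" "F s"]) (auto simp: adapted_process_def)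
  qed
  then have "(\<lambda>(s, \<omega>). Z s \<omega>) \<in> restrict_space borel {0..r} \<Otimes>\<^sub>M F r \<rightarrow>\<^sub>M restrict_space borel C"
    using range r by (intro measurable_restrict_space2)
      (auto simp: space_pair_measure space_restrict_space space_F)
  from measurable_compose[OF this \<sigma>]
  show "(\<lambda>(s, \<omega>). \<sigma> (Z s \<omega>)) \<in> borel_measurable (restrict_space borel {0..r} \<Otimes>\<^sub>M F r)"
    by (simp add: case_prod_beta')
qed

text \<open>Both the simple process and \<open>H\<close> are jointly measurable on
  \<open>{0..t}\<close> with respect to \<open>F t\<close>, so integrating out the time by Tonelli
  leaves a random variable. This is the measurability under which almost sure equality preserves
  convergence in probability.\<close>

lemma borel_measurable_approximation_error:
  fixes H :: "real \<Rightarrow> 'w \<Rightarrow> real ^ 'm ^ 'd"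
  assumes usual: "filtered_prob_space_usual M T F" and t: "0 \<le> t" "t \<le> T"
    and H: "progressively_measurable t F H" and A: "simple_integrand M F t k \<tau> A"
  shows "(\<lambda>\<omega>. \<integral>\<^sup>+s\<in>{0..t}. ennreal ((norm (simple_process k \<tau> A s \<omega> - H s \<omega>))\<^sup>2) \<partial>lborel)
    \<in> borel_measurable M"
proof -
  let ?R = "restrict_space borel {0..t} \<Otimes>\<^sub>M F t"
  let ?L = "restrict_space lborel {0..t}"
  have mono: "\<tau> i \<le> \<tau> j" if "i \<le> j" "j \<le> k" for i j
    using that
  proof (induction j rule: nat_induct_at_least)
    case (Suc j)
    have "\<tau> i \<le> \<tau> j" using Suc by simp
    also have "\<tau> j \<le> \<tau> (Suc j)"
      using A Suc.prems by (simp add: simple_integrand_def)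
    finally show ?case .
  qed simp
  have A_meas: "A i \<in> borel_measurable (F t)" if "i < k" for i
  proof (rule measurable_from_subalg)
    show "A i \<in> borel_measurable (F (\<tau> i))"
      using A that by (simp add: simple_integrand_def)
    show "subalgebra (F t) (F (\<tau> i))"
      using mono[of 0 i] mono[of i k] A that t
      by (intro usual_mono[OF usual]) (auto simp: simple_integrand_def)
  qed
  have "(\<lambda>(s, \<omega>). simple_process k \<tau> A s \<omega>) \<in> borel_measurable ?R"
    unfolding simple_process_def case_prod_beta'
  proof (intro borel_measurable_sum borel_measurable_scaleR)
    fix i assume "i \<in> {..<k}"
    then show "(\<lambda>x. A i (snd x)) \<in> borel_measurable ?R"
      by (intro measurable_compose[OF measurable_snd A_meas]) simp
    have "(indicator {\<tau> i<..\<tau> (Suc i)} :: real \<Rightarrow> real) \<in> borel_measurable (restrict_space borel {0..t})"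
      by (intro measurable_restrict_space1) simp
    then show "(\<lambda>x. indicator {\<tau> i<..\<tau> (Suc i)} (fst x) :: real) \<in> borel_measurable ?R"
      by (rule measurable_compose[OF measurable_fst])
  qed
  moreover have "(\<lambda>(s, \<omega>). H s \<omega>) \<in> borel_measurable ?R"
    using H t by (simp add: progressively_measurable_def)
  ultimately have "(\<lambda>(s, \<omega>). ennreal ((norm (simple_process k \<tau> A s \<omega> - H s \<omega>))\<^sup>2)) \<in> borel_measurable ?R"
    unfolding case_prod_beta' by measurable
  then have "(\<lambda>(\<omega>, s). ennreal ((norm (simple_process k \<tau> A s \<omega> - H s \<omega>))\<^sup>2))
      \<in> borel_measurable (F t \<Otimes>\<^sub>M restrict_space borel {0..t})"
    by (drule_tac measurable_pair_swap) simp
  also have "borel_measurable (F t \<Otimes>\<^sub>M restrict_space borel {0..t}) = borel_measurable (F t \<Otimes>\<^sub>M ?L)"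
    by (intro measurable_cong_sets sets_pair_measure_cong refl sets_restrict_space_cong) simp
  finally have "(\<lambda>\<omega>. \<integral>\<^sup>+s. ennreal ((norm (simple_process k \<tau> A s \<omega> - H s \<omega>))\<^sup>2) \<partial>?L) \<in> borel_measurable (F t)"
    by (intro sigma_finite_measure.borel_measurable_nn_integral sigma_finite_measure_restrict_space
        sigma_finite_lborel) simp_all
  then show ?thesis
    using t usual_subalgebra[OF usual, of t]
    by (intro measurable_from_subalg[of M "F t"]) (simp_all add: nn_integral_restrict_space)
qed

text \<open>Measurability matters here because \<^const>\<open>emeasure\<close> is \<open>0\<close> on non-measurable sets.\<close>

lemma tendsto_zero_in_prob_cong_AE:
  assumes "tendsto_zero_in_prob M Z"
    and [measurable]: "\<And>n. Z n \<in> borel_measurable M" "\<And>n. Z' n \<in> borel_measurable M"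
    and eq: "\<And>n. AE \<omega> in M. Z' n \<omega> = Z n \<omega>"
  shows "tendsto_zero_in_prob M Z'"
proof -
  have "emeasure M {\<omega> \<in> space M. ennreal \<epsilon> < Z' n \<omega>} = emeasure M {\<omega> \<in> space M. ennreal \<epsilon> < Z n \<omega>}" for \<epsilon> n
    by (intro emeasure_eq_AE) (use eq[of n] in \<open>auto\<close>)
  then show ?thesis
    using assms(1) by (simp add: tendsto_zero_in_prob_def)
qed

text \<open>The same simple integrands approximate both processes: outside one null set the
  integrands agree at all times of \<open>{0..t}\<close>, so the approximation errors agree almost
  surely, and the integrals of the simple integrands do not involve \<open>H\<close> at all.\<close>

lemma has_ito_integral_cong_AE:
  assumes usual: "filtered_prob_space_usual M T F" and t: "0 \<le> t" "t \<le> T"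
    and H: "has_ito_integral M F W t H I" and H': "progressively_measurable t F H'"
    and eq: "AE \<omega> in M. \<forall>s\<in>{0..t}. H' s \<omega> = H s \<omega>"
  shows "has_ito_integral M F W t H' I"
proof -
  from H obtain k \<tau> A where prog: "progressively_measurable t F H"
    and sq: "AE \<omega> in M. (\<integral>\<^sup>+s\<in>{0..t}. ennreal ((norm (H s \<omega>))\<^sup>2) \<partial>lborel) < \<infinity>"
    and I: "I \<in> borel_measurable M"
    and A: "\<And>n. simple_integrand M F t (k n) (\<tau> n) (A n)"
    and lim: "tendsto_zero_in_prob M (\<lambda>n \<omega>. \<integral>\<^sup>+s\<in>{0..t}.
          ennreal ((norm (simple_process (k n) (\<tau> n) (A n) s \<omega> - H s \<omega>))\<^sup>2) \<partial>lborel)"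
    and lim_I: "tendsto_zero_in_prob M (\<lambda>n \<omega>.
          ennreal (norm (simple_integral W (k n) (\<tau> n) (A n) \<omega> - I \<omega>)))"
    unfolding has_ito_integral_def by blast
  have "AE \<omega> in M. (\<integral>\<^sup>+s\<in>{0..t}. ennreal ((norm (H' s \<omega>))\<^sup>2) \<partial>lborel) < \<infinity>"
    using sq eq
  proof eventually_elim
    case (elim \<omega>)
    have "(\<integral>\<^sup>+s\<in>{0..t}. ennreal ((norm (H' s \<omega>))\<^sup>2) \<partial>lborel) = (\<integral>\<^sup>+s\<in>{0..t}. ennreal ((norm (H s \<omega>))\<^sup>2) \<partial>lborel)"
      using elim(2) by (intro nn_integral_cong) (simp split: split_indicator)
    with elim(1) show ?case by simp
  qed
  moreover have "tendsto_zero_in_prob M (\<lambda>n \<omega>. \<integral>\<^sup>+s\<in>{0..t}.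
          ennreal ((norm (simple_process (k n) (\<tau> n) (A n) s \<omega> - H' s \<omega>))\<^sup>2) \<partial>lborel)"
  proof (rule tendsto_zero_in_prob_cong_AE[OF lim])
    show "AE \<omega> in M. (\<integral>\<^sup>+s\<in>{0..t}. ennreal ((norm (simple_process (k n) (\<tau> n) (A n) s \<omega> - H' s \<omega>))\<^sup>2) \<partial>lborel)
      = (\<integral>\<^sup>+s\<in>{0..t}. ennreal ((norm (simple_process (k n) (\<tau> n) (A n) s \<omega> - H s \<omega>))\<^sup>2) \<partial>lborel)" for n
      using eq
    proof eventually_elim
      case (elim \<omega>)
      then show ?case by (intro nn_integral_cong) (simp split: split_indicator)
    qed
  qed (intro borel_measurable_approximation_error[OF usual t] prog H' A)+
  ultimately show ?thesis
    unfolding has_ito_integral_def using H' I A lim_I by blast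
qed

text \<open>The integrals involve uncountably many times, so agreement outside a common null set is
  used rather than agreement at each time separately. The Ito integral \<open>I\<close> of the given
  solution is reused.\<close>

lemma satisfies_SDE_indistinguishable:
  fixes Z :: "real \<Rightarrow> 'w \<Rightarrow> real ^ 'd" and \<sigma> :: "real ^ 'd \<Rightarrow> real ^ 'm ^ 'd"
  assumes usual: "filtered_prob_space_usual M T F"
    and sde: "satisfies_SDE M T F W \<mu> \<sigma> x X"
    and adapted: "adapted_process T F Z"
    and cont: "\<And>\<omega>. \<omega> \<in> space M \<Longrightarrow> continuous_on {0..T} (\<lambda>t. Z t \<omega>)"
    and range: "\<And>t \<omega>. t \<in> {0..T} \<Longrightarrow> \<omega> \<in> space M \<Longrightarrow> Z t \<omega> \<in> C"
    and \<sigma>: "\<sigma> \<in> borel_measurable (restrict_space borel C)"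
    and eq: "AE \<omega> in M. \<forall>t\<in>{0..T}. Z t \<omega> = X t \<omega>"
  shows "satisfies_SDE M T F W \<mu> \<sigma> x Z"
  unfolding satisfies_SDE_def
proof (intro ballI)
  fix t assume t: "t \<in> {0..T}"
  then obtain I where I: "has_ito_integral M F W t (\<lambda>s \<omega>. \<sigma> (X s \<omega>)) I"
    and ae: "AE \<omega> in M.
      (\<integral>\<^sup>+s\<in>{0..T}. ennreal (norm (\<mu> (X s \<omega>)) + (onorm ((*v) (\<sigma> (X s \<omega>))))\<^sup>2) \<partial>lborel) < \<infinity> \<and>
      X t \<omega> = x + (LBINT s:{0..t}. \<mu> (X s \<omega>)) + I \<omega>"
    using sde unfolding satisfies_SDE_def by blast
  have "has_ito_integral M F W t (\<lambda>s \<omega>. \<sigma> (Z s \<omega>)) I"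
  proof (rule has_ito_integral_cong_AE[OF usual _ _ I])
    show "progressively_measurable t F (\<lambda>s \<omega>. \<sigma> (Z s \<omega>))"
      by (rule progressively_measurable_continuous_adapted[OF usual _ adapted cont range \<sigma>]) (use t in auto)
    show "AE \<omega> in M. \<forall>s\<in>{0..t}. \<sigma> (Z s \<omega>) = \<sigma> (X s \<omega>)"
      using eq by eventually_elim (use t in auto)
  qed (use t in auto)
  moreover have "AE \<omega> in M.
      (\<integral>\<^sup>+s\<in>{0..T}. ennreal (norm (\<mu> (Z s \<omega>)) + (onorm ((*v) (\<sigma> (Z s \<omega>))))\<^sup>2) \<partial>lborel) < \<infinity> \<and>
      Z t \<omega> = x + (LBINT s:{0..t}. \<mu> (Z s \<omega>)) + I \<omega>"
    using ae eq
  proof eventually_elim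
    case (elim \<omega>)
    have "(\<integral>\<^sup>+s\<in>{0..T}. ennreal (norm (\<mu> (Z s \<omega>)) + (onorm ((*v) (\<sigma> (Z s \<omega>))))\<^sup>2) \<partial>lborel)
      = (\<integral>\<^sup>+s\<in>{0..T}. ennreal (norm (\<mu> (X s \<omega>)) + (onorm ((*v) (\<sigma> (X s \<omega>))))\<^sup>2) \<partial>lborel)"
      using elim(2) by (intro nn_integral_cong) (simp split: split_indicator)
    moreover have "(LBINT s:{0..t}. \<mu> (Z s \<omega>)) = (LBINT s:{0..t}. \<mu> (X s \<omega>))"
      using elim(2) t by (intro set_lebesgue_integral_cong) auto
    ultimately show ?case using elim t by simp
  qed
  ultimately show "\<exists>I. has_ito_integral M F W t (\<lambda>s \<omega>. \<sigma> (Z s \<omega>)) I \<and>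
      (AE \<omega> in M.
        (\<integral>\<^sup>+s\<in>{0..T}. ennreal (norm (\<mu> (Z s \<omega>)) + (onorm ((*v) (\<sigma> (Z s \<omega>))))\<^sup>2) \<partial>lborel) < \<infinity> \<and>
        Z t \<omega> = x + (LBINT s:{0..t}. \<mu> (Z s \<omega>)) + I \<omega>)"
    by blast
qed

section \<open>The continuous extension\<close>

text \<open>The supremum itself is the constant. The division is undone where \<open>c x y\<close>
  is positive; the remaining case, in the application the diagonal, is handled by
  \<open>zero\<close>.\<close>

lemma SUP_ratio_finite_imp_bound:
  fixes N :: "'a \<Rightarrow> 'a \<Rightarrow> ennreal" and c :: "'a \<Rightarrow> 'a \<Rightarrow> real"
  assumes fin: "(SUP (x, y)\<in>A \<times> A. N x y / ennreal (c x y)) < \<infinity>"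
    and zero: "\<And>x y. x \<in> A \<Longrightarrow> y \<in> A \<Longrightarrow> c x y \<le> 0 \<Longrightarrow> N x y = 0"
  shows "\<exists>C\<ge>0. \<forall>x\<in>A. \<forall>y\<in>A. N x y \<le> ennreal (C * c x y)"
proof -
  let ?K = "SUP (x, y)\<in>A \<times> A. N x y / ennreal (c x y)"
  have K: "?K = ennreal (enn2real ?K)"
    using fin by simp
  have "N x y \<le> ennreal (enn2real ?K * c x y)" if xy: "x \<in> A" "y \<in> A" for x y
  proof (cases "c x y \<le> 0")
    case False
    have "N x y / ennreal (c x y) \<le> ?K"
      using xy by (intro SUP_upper2[of "(x, y)"]) auto
    also note K
    finally have "N x y / ennreal (c x y) * ennreal (c x y) \<le> ennreal (enn2real ?K) * ennreal (c x y)"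
      by (intro mult_right_mono) simp_all
    also have "N x y / ennreal (c x y) * ennreal (c x y) = N x y"
      using False by (simp add: ennreal_divide_times ennreal_divide_self)
    finally show ?thesis
      by (simp add: ennreal_mult')
  qed (simp add: zero[OF xy])
  then show ?thesis
    by (intro exI[of _ "enn2real ?K"]) simp
qed

theorem theorem3p11:
  fixes T p \<alpha> :: real
    and D :: "(real ^ 'd) set"
    and \<mu> :: "real ^ 'd \<Rightarrow> real ^ 'd"
    and \<sigma> :: "real ^ 'd \<Rightarrow> real ^ 'm ^ 'd"
    and M :: "'w measure"
    and F :: "real \<Rightarrow> 'w measure"
    and W :: "real \<Rightarrow> 'w \<Rightarrow> real ^ 'm"
    and X :: "real ^ 'd \<Rightarrow> real \<Rightarrow> 'w \<Rightarrow> real ^ 'd"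
  assumes "0 < T"
    and "D \<noteq> {}"
    and "\<mu> \<in> borel_measurable (restrict_space borel (closure D))"
    and "\<sigma> \<in> borel_measurable (restrict_space borel (closure D))"
    and "filtered_prob_space_usual M T F"
    and "standard_brownian_motion M T F W"
    and "\<And>x t \<omega>. x \<in> D \<Longrightarrow> t \<in> {0..T} \<Longrightarrow> \<omega> \<in> space M \<Longrightarrow> X x t \<omega> \<in> closure D"
    and "\<And>x. x \<in> D \<Longrightarrow> adapted_process T F (X x)"
    and "\<And>x \<omega>. x \<in> D \<Longrightarrow> \<omega> \<in> space M \<Longrightarrow> continuous_on {0..T} (\<lambda>t. X x t \<omega>)"
    and "\<And>x. x \<in> D \<Longrightarrow> satisfies_SDE M T F W \<mu> \<sigma> x (X x)"
    and "real CARD('d) < p"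
    and "real CARD('d) / p < \<alpha>" and "\<alpha> \<le> 1"
    and "\<And>z. z \<in> D \<Longrightarrow> in_Lp M p (\<lambda>\<omega>. path_bcontfun T (\<lambda>t. X z t \<omega>))"
    and "\<And>n::nat. (SUP (x, y) \<in> (D \<inter> ball 0 (real n)) \<times> (D \<inter> ball 0 (real n)).
           (\<integral>\<^sup>+\<omega>. (SUP t\<in>{0..T}. ennreal (norm (X x t \<omega> - X y t \<omega>) powr p)) \<partial>M)
             / ennreal (norm (x - y) powr (\<alpha> * p))) < \<infinity>"
  shows "\<exists>Y :: real \<Rightarrow> real ^ 'd \<Rightarrow> 'w \<Rightarrow> real ^ 'd.
           (\<lambda>(t, x, \<omega>). Y t x \<omega>)
             \<in> restrict_space borel {0..T} \<Otimes>\<^sub>M (restrict_space borel (closure D) \<Otimes>\<^sub>M M)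
               \<rightarrow>\<^sub>M restrict_space borel (closure D) \<and>
           (\<forall>\<omega>\<in>space M. continuous_on ({0..T} \<times> closure D) (\<lambda>(t, x). Y t x \<omega>)) \<and>
           (\<forall>x\<in>closure D. adapted_process T F (\<lambda>t. Y t x)) \<and>
           (\<forall>x\<in>D. satisfies_SDE M T F W \<mu> \<sigma> x (\<lambda>t. Y t x))"
proof -
  note usual = assms(5) and X_range = assms(7) and X_adapted = assms(8) and X_cont = assms(9)
    and ratio = assms(15)
  have p: "0 < p" using assms(11) by (meson of_nat_0_le_iff order_le_less_trans)
  have \<beta>: "real CARD('d) < \<alpha> * p" using assms(12) p by (simp add: divide_less_eq)
  have subM: "subalgebra M (F t)" if "t \<in> {0..T}" for t
    using usual_subalgebra[OF usual that] .
  have space_F: "space (F t) = space M" if "t \<in> {0..T}" for t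
    using subM[OF that] by (simp add: subalgebra_def)
  have X_F: "X x t \<in> borel_measurable (F t)" if "x \<in> D" "t \<in> {0..T}" for x t
    using X_adapted that by (simp add: adapted_process_def)
  have X_M: "X x t \<in> borel_measurable M" if "x \<in> D" "t \<in> {0..T}" for x t
    using measurable_from_subalg[OF subM X_F] that by blast

  \<comment> \<open>The countable set is left free because the fact is used twice: for
    \<open>D'\<close> to construct \<open>Y\<close>, and for \<open>insert x D'\<close> to compare
    \<open>Y\<close> with the solution started at \<open>x\<close>.\<close>
  have local_cauchy: "AE \<omega> in M. \<forall>x \<epsilon>. 0 < \<epsilon> \<longrightarrow> (\<exists>\<delta>>0. \<forall>y\<in>E. \<forall>z\<in>E. dist y x < \<delta> \<longrightarrow> dist z x < \<delta> \<longrightarrow>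
      (\<forall>t\<in>{0..T}. dist (X y t \<omega>) (X z t \<omega>) \<le> \<epsilon>))" if "countable E" "E \<subseteq> D" for E
  proof (rule kolmogorov_chentsov_locally[OF that p \<beta>])
    show "(\<lambda>\<omega>. SUP t\<in>{0..T}. ennreal (norm (X x t \<omega> - X y t \<omega>) powr p)) \<in> borel_measurable M"
      if "x \<in> D" "y \<in> D" for x y
    proof (rule borel_measurable_SUP_continuous)
      show "continuous_on {0..T} (\<lambda>t. norm (X x t \<omega> - X y t \<omega>) powr p)" if "\<omega> \<in> space M" for \<omega>
        using X_cont \<open>x \<in> D\<close> \<open>y \<in> D\<close> that p
        by (intro continuous_on_powr' continuous_on_norm continuous_on_diff continuous_on_const) auto
      show "(\<lambda>\<omega>. norm (X x t \<omega> - X y t \<omega>) powr p) \<in> borel_measurable M" if "t \<in> {0..T}" for t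
        using X_M[OF \<open>x \<in> D\<close> that] X_M[OF \<open>y \<in> D\<close> that] by measurable
    qed
    show "\<exists>C\<ge>0. \<forall>x\<in>D \<inter> ball 0 (real n). \<forall>y\<in>D \<inter> ball 0 (real n).
      (\<integral>\<^sup>+\<omega>. (SUP t\<in>{0..T}. ennreal (norm (X x t \<omega> - X y t \<omega>) powr p)) \<partial>M)
        \<le> ennreal (C * norm (x - y) powr (\<alpha> * p))" for n
    proof (rule SUP_ratio_finite_imp_bound[OF ratio])
      fix x y :: "real ^ 'd" assume "norm (x - y) powr (\<alpha> * p) \<le> 0"
      then have "x = y" by (simp add: antisym_conv)
      moreover have "(SUP t\<in>{0..T}. 0::ennreal) = 0"
        using assms(1) by (intro SUP_eq_const) auto
      ultimately show "(\<integral>\<^sup>+\<omega>. (SUP t\<in>{0..T}. ennreal (norm (X x t \<omega> - X y t \<omega>) powr p)) \<partial>M) = 0"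
        using p by simp
    qed
  qed

  obtain D' where D': "countable D'" "D' \<subseteq> D" "D \<subseteq> closure D'"
    by (rule separable)
  have "closure D \<subseteq> closure D'"
    using D'(3) by (simp add: closure_minimal)
  then have "\<exists>u. (\<forall>k. u k \<in> D') \<and> u \<longlonglongrightarrow> x" if "x \<in> closure D" for x
    using that closure_sequential[of x D'] by blast
  then obtain s where s: "\<And>x k. x \<in> closure D \<Longrightarrow> s x k \<in> D'" "\<And>x. x \<in> closure D \<Longrightarrow> s x \<longlonglongrightarrow> x"
    by metis
  \<comment> \<open>A measurable null set containing the exceptional event. By the usual conditions
    it belongs to every \<open>F t\<close>, so modifying the process on it preserves
    adaptedness.\<close>
  obtain N where N: "{\<omega> \<in> space M. \<not> (\<forall>x \<epsilon>. 0 < \<epsilon> \<longrightarrow> (\<exists>\<delta>>0. \<forall>y\<in>D'. \<forall>z\<in>D'. dist y x < \<delta> \<longrightarrow> dist z x < \<delta> \<longrightarrow>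
      (\<forall>t\<in>{0..T}. dist (X y t \<omega>) (X z t \<omega>) \<le> \<epsilon>)))} \<subseteq> N" "emeasure M N = 0" "N \<in> sets M"
    using local_cauchy[OF D'(1,2)] by (rule AE_E)
  have N_F: "N \<in> sets (F t)" if "t \<in> {0..T}" for t
    using usual_null_sets[OF usual, of t] that N(2,3) by (auto simp: null_sets_def)
  obtain x0 where x0: "x0 \<in> D" using assms(2) by blast
  \<comment> \<open>The constant \<open>x0\<close> on \<open>N\<close> keeps every path continuous
    and every value in the closure of \<open>D\<close>.\<close>
  define Y where "Y t x \<omega> = (if \<omega> \<in> N then x0 else lim (\<lambda>k. X (s x k) t \<omega>))" for t x \<omega>

  have lim: "(\<lambda>k. X (s x k) t \<omega>) \<longlonglongrightarrow> Y t x \<omega>"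
    and cont_good: "continuous_on ({0..T} \<times> closure D) (\<lambda>(t, x). Y t x \<omega>)"
    if \<omega>: "\<omega> \<in> space M" "\<omega> \<notin> N" and tx: "t \<in> {0..T}" "x \<in> closure D" for t x \<omega>
  proof -
    note lims = lim_along_dense_sequences[where f = "\<lambda>x t. X x t \<omega>" and D = D' and S = "{0..T}" and Z = "closure D" and s = s]
    have good: "\<exists>\<delta>>0. \<forall>y\<in>D'. \<forall>z\<in>D'. dist y x < \<delta> \<longrightarrow> dist z x < \<delta> \<longrightarrow>
      (\<forall>t\<in>{0..T}. dist (X y t \<omega>) (X z t \<omega>) \<le> \<epsilon>)" if "0 < \<epsilon>" for x \<epsilon>
      using N(1) \<omega> that by blast
    have cont: "continuous_on {0..T} (\<lambda>t. X x t \<omega>)" if "x \<in> D'" for x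
      using X_cont D'(2) \<omega>(1) that by blast
    show "(\<lambda>k. X (s x k) t \<omega>) \<longlonglongrightarrow> Y t x \<omega>"
      using lims(1)[OF cont s good tx(2,1)] \<omega>(2) by (simp add: Y_def)
    show "continuous_on ({0..T} \<times> closure D) (\<lambda>(t, x). Y t x \<omega>)"
      using lims(2)[OF cont s good] \<omega>(2) by (simp add: Y_def)
  qed
  have Y_cont: "continuous_on ({0..T} \<times> closure D) (\<lambda>(t, x). Y t x \<omega>)" if "\<omega> \<in> space M" for \<omega>
  proof (cases "\<omega> \<in> N")
    case True
    then show ?thesis by (simp add: Y_def case_prod_beta')
  next
    case False
    have "0 \<in> {0..T}" "x0 \<in> closure D"
      using assms(1) x0 closure_subset by auto
    with cont_good[OF that False] show ?thesis by blast
  qed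
  have Y_cont_t: "continuous_on {0..T} (\<lambda>t. Y t x \<omega>)" if "x \<in> closure D" "\<omega> \<in> space M" for x \<omega>
  proof -
    have "continuous_on {0..T} (\<lambda>t. (t, x))" by (intro continuous_intros)
    from continuous_on_compose2[OF Y_cont[OF that(2)] this] show ?thesis
      using that(1) by auto
  qed
  have Y_range: "Y t x \<omega> \<in> closure D" if "t \<in> {0..T}" "x \<in> closure D" "\<omega> \<in> space M" for t x \<omega>
  proof (cases "\<omega> \<in> N")
    case True
    then show ?thesis using x0 closure_subset by (auto simp: Y_def)
  next
    case False
    have "X (s x k) t \<omega> \<in> closure D" for k
      using X_range s(1) D'(2) that by blast
    with lim[OF that(3) False that(1,2)] show ?thesis
      by (rule closed_sequentially[OF closed_closure, rotated])
  qed
  have Y_F: "Y t x \<in> borel_measurable (F t)" if tx: "t \<in> {0..T}" "x \<in> closure D" for t x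
  proof (rule borel_measurable_LIMSEQ_metric)
    \<comment> \<open>With the modification on \<open>N\<close> built into the approximants, they
      converge at every outcome and are \<open>F t\<close>-measurable.\<close>
    show "(\<lambda>\<omega>. if \<omega> \<in> N then x0 else X (s x k) t \<omega>) \<in> borel_measurable (F t)" for k
      using X_F[of "s x k" t] s(1)[OF tx(2)] D'(2) tx(1) N_F[OF tx(1)]
      by (intro measurable_If_set) auto
    show "(\<lambda>k. if \<omega> \<in> N then x0 else X (s x k) t \<omega>) \<longlonglongrightarrow> Y t x \<omega>" if "\<omega> \<in> space (F t)" for \<omega>
      using lim[OF _ _ tx, of \<omega>] that space_F[OF tx(1)] by (cases "\<omega> \<in> N") (simp_all add: Y_def)
  qed
  have Y_adapted: "adapted_process T F (\<lambda>t. Y t x)" if "x \<in> closure D" for x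
    using Y_F that by (simp add: adapted_process_def)

  have "(\<lambda>((t, x), \<omega>). Y t x \<omega>) \<in> borel_measurable (restrict_space borel ({0..T} \<times> closure D) \<Otimes>\<^sub>M M)"
    using borel_measurable_pair_caratheodory[of M "{0..T} \<times> closure D" "\<lambda>z. Y (fst z) (snd z)"]
      Y_cont measurable_from_subalg[OF subM Y_F] by (auto simp: case_prod_beta')
  \<comment> \<open>Joint measurability was obtained with the pair \<open>(t, x)\<close> as a single
    index; this map regroups the nested product accordingly.\<close>
  moreover have "(\<lambda>(t, x, \<omega>). ((t, x), \<omega>)) \<in> restrict_space borel {0..T} \<Otimes>\<^sub>M (restrict_space borel (closure D) \<Otimes>\<^sub>M M)
      \<rightarrow>\<^sub>M restrict_space borel ({0..T} \<times> closure D) \<Otimes>\<^sub>M M"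
  proof -
    let ?P = "restrict_space borel {0..T} \<Otimes>\<^sub>M (restrict_space borel (closure D) \<Otimes>\<^sub>M M)"
    have t: "(\<lambda>z. fst z) \<in> ?P \<rightarrow>\<^sub>M borel"
      by (rule measurable_compose[OF measurable_fst measurable_restrict_space1]) simp
    have x: "(\<lambda>z. fst (snd z)) \<in> ?P \<rightarrow>\<^sub>M borel"
      by (rule measurable_compose[OF measurable_snd measurable_compose[OF measurable_fst measurable_restrict_space1]]) simp
    have \<omega>: "(\<lambda>z. snd (snd z)) \<in> ?P \<rightarrow>\<^sub>M M"
      by measurable
    have "(\<lambda>z. (fst z, fst (snd z))) \<in> ?P \<rightarrow>\<^sub>M restrict_space borel ({0..T} \<times> closure D)"
      using measurable_Pair[OF t x]
      by (intro measurable_restrict_space2) (auto simp: space_pair_measure space_restrict_space borel_prod)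
    from measurable_Pair[OF this \<omega>] show ?thesis
      by (simp add: case_prod_beta')
  qed
  ultimately have "(\<lambda>(t, x, \<omega>). Y t x \<omega>) \<in> borel_measurable (restrict_space borel {0..T} \<Otimes>\<^sub>M (restrict_space borel (closure D) \<Otimes>\<^sub>M M))"
    by (drule_tac measurable_compose[rotated]) (auto simp: case_prod_beta')
  then have Y_meas: "(\<lambda>(t, x, \<omega>). Y t x \<omega>) \<in> restrict_space borel {0..T} \<Otimes>\<^sub>M (restrict_space borel (closure D) \<Otimes>\<^sub>M M)
      \<rightarrow>\<^sub>M restrict_space borel (closure D)"
    using Y_range by (intro measurable_restrict_space2) (auto simp: space_pair_measure space_restrict_space)

  have "satisfies_SDE M T F W \<mu> \<sigma> x (\<lambda>t. Y t x)" if x: "x \<in> D" for x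
  proof (rule satisfies_SDE_indistinguishable[OF usual assms(10)[OF x] Y_adapted Y_cont_t Y_range assms(4)])
    show xc: "x \<in> closure D" "x \<in> closure D" "x \<in> closure D"
      using x closure_subset by auto
    have "AE \<omega> in M. \<omega> \<notin> N"
      using N(2,3) by (intro AE_not_in) auto
    \<comment> \<open>Adding \<open>x\<close> to \<open>D'\<close> allows \<open>X x\<close> itself
      to be compared with the approximating \<open>X (s x k)\<close>, so both \<open>X x\<close> and
      \<open>Y\<close> are limits of the same sequence. The null set may depend on \<open>x\<close>,
      since the equation is claimed for each \<open>x\<close> separately.\<close>
    moreover have "AE \<omega> in M. \<forall>y \<epsilon>. 0 < \<epsilon> \<longrightarrow> (\<exists>\<delta>>0. \<forall>v\<in>insert x D'. \<forall>z\<in>insert x D'. dist v y < \<delta> \<longrightarrow> dist z y < \<delta> \<longrightarrow>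
      (\<forall>t\<in>{0..T}. dist (X v t \<omega>) (X z t \<omega>) \<le> \<epsilon>))"
      using D' x by (intro local_cauchy) auto
    ultimately show "AE \<omega> in M. \<forall>t\<in>{0..T}. Y t x \<omega> = X x t \<omega>"
      using AE_space
    proof eventually_elim
      case (elim \<omega>)
      show ?case
      proof
        fix t assume t: "t \<in> {0..T}"
        have "(\<lambda>k. X (s x k) t \<omega>) \<longlonglongrightarrow> X x t \<omega>"
        proof (rule metric_LIMSEQ_I)
          fix r :: real assume "0 < r"
          then have "0 < r / 2" by simp
          with elim(2) obtain \<delta> where \<delta>: "\<delta> > 0" "\<And>v z. v \<in> insert x D' \<Longrightarrow> z \<in> insert x D' \<Longrightarrow>
              dist v x < \<delta> \<Longrightarrow> dist z x < \<delta> \<Longrightarrow> dist (X v t \<omega>) (X z t \<omega>) \<le> r / 2"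
            using t by meson
          obtain n where n: "\<And>k. k \<ge> n \<Longrightarrow> dist (s x k) x < \<delta>"
            using metric_LIMSEQ_D[OF s(2)[OF xc(1)] \<delta>(1)] by blast
          have "dist (X (s x k) t \<omega>) (X x t \<omega>) < r" if "k \<ge> n" for k
            using \<delta>(2)[of "s x k" x] n[OF that] s(1)[OF xc(1)] \<delta>(1) \<open>0 < r\<close> by fastforce
          then show "\<exists>n. \<forall>k\<ge>n. dist (X (s x k) t \<omega>) (X x t \<omega>) < r" by blast
        qed
        with lim[OF elim(3,1) t xc(1)] show "Y t x \<omega> = X x t \<omega>"
          by (rule LIMSEQ_unique)
      qed
    qed
  qed
  then show ?thesis
    using Y_meas Y_cont Y_adapted by blast
qed

end
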